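(* Let $q_+,q_-\in\mathbb{C}$ and let $\phi_{q_+,q_-}\colon B(\infty)\to\mathbb{C}$ be the signed reflection function on the infinite hyperoctahedral group. The following conditions are equivalent: (i) $\phi_{q_+,q_-}$ is positive definite on $B(\infty)$; (ii) $\phi_{q_+,q_-}$ is a character of $B(\infty)$; (iii) $\phi_{q_+,q_-}$ is an extreme character of $B(\infty)$; (iv) either $q_+=\frac{\epsilon}{M+N}$ and $q_-=\frac{M-N}{M+N}$ for some $M,N\in\mathbb{N}=\{0,1,2,\dots\}$ with $M+N\neq 0$ and some $\epsilon\in\{1,-1\}$, or $q_+=0$ and $-1\le q_-\le 1$.
   Context: For $n\ge 1$ let $[\pm n]=\{-n,\dots,-1,1,\dots,n\}$ and write $\overline{i}=-i$. The hyperoctahedral group $B(n)$ is the group of permutations $\sigma$ of $[\pm n]$ with $\sigma(\overline{i})=\overline{\sigma(i)}$ for all $i$. $B(n-1)$ embeds in $B(n)$ as the subgroup fixing $n$ and $\overline{n}$, and $B(\infty)=\bigcup_n B(n)$ is the inductive limit. Cycle type: write $\sigma$ as a product of disjoint cycles (fixed points omitted). For a cycle $c=(a_1\,\dots\,a_k)$ put $\overline{c}=(\overline{a_1}\,\dots\,\overline{a_k})$. Either $c$ and $\overline{c}$ are disjoint, in which case the pair $c,\overline{c}$ is one positive cycle of length $k$, or $c=\overline{c}$, in which case $k=2m$ is even and $c$ is one negative cycle of length $m$. Let $\rho^+$ (resp. $\rho^-$) be the partition listing the lengths of the positive (resp. negative) cycles of $\sigma$. For a partition $\rho$, $|\rho|$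 is the sum of its parts, $\ell(\rho)$ the number of parts, and $\|\rho\|=|\rho|-\ell(\rho)$. The signed reflection function on $B(\infty)$ is $$\phi_{q_+,q_-}(\sigma)=q_+^{\|\rho^+\|+\|\rho^-\|}\,q_-^{\ell(\rho^-)}$$ (with $0^0=1$), where $(\rho^+,\rho^-)$ is the cycle type of $\sigma$. A function $\phi\colon G\to\mathbb{C}$ on a group is positive definite if $\sum_{i,j=1}^k z_i\overline{z_j}\,\phi(g_j^{-1}g_i)\ge 0$ for all $k\ge1$, $z_1,\dots,z_k\in\mathbb{C}$, $g_1,\dots,g_k\in G$. It is central if $\phi(hgh^{-1})=\phi(g)$ for all $g,h\in G$. A character of $G$ is a central positive definite function with value $1$ at the identity; an extreme character is an extreme point of the convex set of all characters. *)

theory Defs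
  imports
    Complex_Main
    "HOL-Library.Multiset"
    "HOL-Library.Nonpos_Ints"
    "HOL-Combinatorics.Orbits"
    "HOL-Algebra.Group"
begin

section \<open>Hyperoctahedral groups\<close>

text \<open>
  Permutations of \<open>[\<plusminus>n]\<close> are represented as permutations of all of \<open>int\<close> that fix every point
  outside \<open>[\<plusminus>n]\<close>. With this convention the embedding of \<open>B(n - 1)\<close> into \<open>B(n)\<close> is an inclusion
  and the inductive limit is a plain union.
\<close>

definition pm_set :: "nat \<Rightarrow> int set" where
  "pm_set n = {- int n..int n} - {0}"

definition hyperoct :: "nat \<Rightarrow> (int \<Rightarrow> int) set" where
  "hyperoct n = {\<sigma>. \<sigma> permutes pm_set n \<and> (\<forall>i\<in>pm_set n. \<sigma> (- i) = - \<sigma> i)}"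

definition hyperoct_inf :: "(int \<Rightarrow> int) monoid" where
  "hyperoct_inf = \<lparr>carrier = (\<Union>n\<in>{1..}. hyperoct n), mult = (\<circ>), one = id\<rparr>"

lemma pm_set_uminus [simp]: "- i \<in> pm_set n \<longleftrightarrow> i \<in> pm_set n"
  by (auto simp: pm_set_def)

lemma hyperoct_uminus:
  assumes "\<sigma> \<in> hyperoct n"
  shows "\<sigma> (- i) = - \<sigma> i"
proof (cases "i \<in> pm_set n")
  case True
  then show ?thesis using assms by (simp add: hyperoct_def)
next
  case False
  with assms show ?thesis
    using permutes_not_in[of \<sigma> "pm_set n" i] permutes_not_in[of \<sigma> "pm_set n" "- i"]
    by (simp add: hyperoct_def)
qed

lemma hyperoct_mono: "m \<le> n \<Longrightarrow> hyperoct m \<subseteq> hyperoct n"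
proof
  fix \<sigma> assume mn: "m \<le> n" and s: "\<sigma> \<in> hyperoct m"
  have "pm_set m \<subseteq> pm_set n" using mn by (auto simp: pm_set_def)
  then have "\<sigma> permutes pm_set n"
    using s permutes_subset by (auto simp: hyperoct_def)
  then show "\<sigma> \<in> hyperoct n"
    using hyperoct_uminus[OF s] by (simp add: hyperoct_def)
qed

lemma hyperoct_comp:
  assumes "\<sigma> \<in> hyperoct n" "\<tau> \<in> hyperoct n"
  shows "\<sigma> \<circ> \<tau> \<in> hyperoct n"
  using assms hyperoct_uminus[OF assms(1)] hyperoct_uminus[OF assms(2)]
  by (auto simp: hyperoct_def intro: permutes_compose)

lemma hyperoct_inv:
  assumes "\<sigma> \<in> hyperoct n"
  shows "inv_into UNIV \<sigma> \<in> hyperoct n"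
proof -
  have p: "\<sigma> permutes pm_set n" using assms by (simp add: hyperoct_def)
  have "inv_into UNIV \<sigma> (- i) = - inv_into UNIV \<sigma> i" for i
    by (metis hyperoct_uminus[OF assms] permutes_inverses[OF p])
  then show ?thesis using permutes_inv[OF p] by (simp add: hyperoct_def)
qed

lemma group_hyperoct_inf: "group hyperoct_inf"
proof (rule groupI)
  fix \<sigma> \<tau>
  assume "\<sigma> \<in> carrier hyperoct_inf" "\<tau> \<in> carrier hyperoct_inf"
  then obtain m n where "m \<ge> 1" "\<sigma> \<in> hyperoct m" "\<tau> \<in> hyperoct n"
    by (auto simp: hyperoct_inf_def)
  then have "\<sigma> \<circ> \<tau> \<in> hyperoct (max m n)" "max m n \<ge> 1"
    using hyperoct_mono[of m "max m n"] hyperoct_mono[of n "max m n"]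
    by (auto intro!: hyperoct_comp)
  then show "\<sigma> \<otimes>\<^bsub>hyperoct_inf\<^esub> \<tau> \<in> carrier hyperoct_inf"
    by (auto simp: hyperoct_inf_def)
next
  have "id \<in> hyperoct 1" by (simp add: hyperoct_def permutes_id)
  then show "\<one>\<^bsub>hyperoct_inf\<^esub> \<in> carrier hyperoct_inf"
    by (auto simp: hyperoct_inf_def)
next
  fix \<sigma> assume "\<sigma> \<in> carrier hyperoct_inf"
  then obtain n where n: "n \<ge> 1" "\<sigma> \<in> hyperoct n" by (auto simp: hyperoct_inf_def)
  then have "inv_into UNIV \<sigma> \<circ> \<sigma> = id"
    by (auto simp: hyperoct_def permutes_inv_o)
  with n hyperoct_inv
  show "\<exists>\<tau>\<in>carrier hyperoct_inf. \<tau> \<otimes>\<^bsub>hyperoct_inf\<^esub> \<sigma> = \<one>\<^bsub>hyperoct_inf\<^esub>"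
    by (intro bexI[of _ "inv_into UNIV \<sigma>"]) (auto simp: hyperoct_inf_def)
qed (auto simp: hyperoct_inf_def comp_assoc)


section \<open>Cycle type and the signed reflection function\<close>

definition moved :: "('a \<Rightarrow> 'a) \<Rightarrow> 'a set" where
  "moved \<sigma> = {i. \<sigma> i \<noteq> i}"

text \<open>
  The nontrivial factors in the disjoint cycle decomposition, each as a permutation in its own right.
  The length of such a factor \<open>c\<close> is \<open>card (moved c)\<close>.
\<close>

definition cycle_factors :: "('a \<Rightarrow> 'a) \<Rightarrow> ('a \<Rightarrow> 'a) set" where
  "cycle_factors \<sigma> = (\<lambda>i. perm_restrict \<sigma> (orbit \<sigma> i)) ` moved \<sigma>"

text \<open>For a cycle \<open>c = (a\<^sub>1 \<dots> a\<^sub>k)\<close> this is the cycle \<open>(- a\<^sub>1 \<dots> - a\<^sub>k)\<close>.\<close>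

definition bar_cycle :: "(int \<Rightarrow> int) \<Rightarrow> int \<Rightarrow> int" where
  "bar_cycle c = (\<lambda>i. - c (- i))"

text \<open>
  A positive cycle is an unordered pair \<open>{c, bar_cycle c}\<close>; the two members have the same
  length, which \<open>the_elem\<close> extracts.
\<close>

definition positive_cycles :: "(int \<Rightarrow> int) \<Rightarrow> (int \<Rightarrow> int) set set" where
  "positive_cycles \<sigma> =
     {{c, bar_cycle c} | c. c \<in> cycle_factors \<sigma> \<and> moved c \<inter> moved (bar_cycle c) = {}}"

definition negative_cycles :: "(int \<Rightarrow> int) \<Rightarrow> (int \<Rightarrow> int) set" where
  "negative_cycles \<sigma> = {c \<in> cycle_factors \<sigma>. bar_cycle c = c}"

definition rho_plus :: "(int \<Rightarrow> int) \<Rightarrow> nat multiset" where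
  "rho_plus \<sigma> =
     image_mset (\<lambda>P. the_elem ((\<lambda>c. card (moved c)) ` P)) (mset_set (positive_cycles \<sigma>))"

definition rho_minus :: "(int \<Rightarrow> int) \<Rightarrow> nat multiset" where
  "rho_minus \<sigma> = image_mset (\<lambda>c. card (moved c) div 2) (mset_set (negative_cycles \<sigma>))"

text \<open>Parts of a partition are positive, so the subtraction does not truncate.\<close>

definition partition_norm :: "nat multiset \<Rightarrow> nat" where
  "partition_norm \<rho> = sum_mset \<rho> - size \<rho>"

definition signed_reflection :: "complex \<Rightarrow> complex \<Rightarrow> (int \<Rightarrow> int) \<Rightarrow> complex" where
  "signed_reflection qp qm \<sigma> =
     qp ^ (partition_norm (rho_plus \<sigma>) + partition_norm (rho_minus \<sigma>)) * qm ^ size (rho_minus \<sigma>)"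


section \<open>Characters\<close>

text \<open>
  A function on a group \<open>G\<close> is only looked at on \<open>carrier G\<close>. \<open>\<real>\<^sub>\<ge>\<^sub>0\<close> is the set of nonnegative
  reals inside \<open>complex\<close>, so membership includes that the sum is real.
\<close>

definition positive_definite_on :: "('a, 'b) monoid_scheme \<Rightarrow> ('a \<Rightarrow> complex) \<Rightarrow> bool" where
  "positive_definite_on G \<phi> \<longleftrightarrow>
     (\<forall>k\<ge>1. \<forall>(z :: nat \<Rightarrow> complex) g. g \<in> {1..k} \<rightarrow> carrier G \<longrightarrow>
        (\<Sum>i=1..k. \<Sum>j=1..k. z i * cnj (z j) * \<phi> (inv\<^bsub>G\<^esub> (g j) \<otimes>\<^bsub>G\<^esub> g i)) \<in> \<real>\<^sub>\<ge>\<^sub>0)"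

definition central_on :: "('a, 'b) monoid_scheme \<Rightarrow> ('a \<Rightarrow> complex) \<Rightarrow> bool" where
  "central_on G \<phi> \<longleftrightarrow>
     (\<forall>g\<in>carrier G. \<forall>h\<in>carrier G. \<phi> (h \<otimes>\<^bsub>G\<^esub> g \<otimes>\<^bsub>G\<^esub> inv\<^bsub>G\<^esub> h) = \<phi> g)"

definition is_character :: "('a, 'b) monoid_scheme \<Rightarrow> ('a \<Rightarrow> complex) \<Rightarrow> bool" where
  "is_character G \<phi> \<longleftrightarrow> central_on G \<phi> \<and> positive_definite_on G \<phi> \<and> \<phi> \<one>\<^bsub>G\<^esub> = 1"

text \<open>
  This is \<open>extreme_point_of\<close> spelled out for the set of characters, since function types are not
  in class \<open>real_vector\<close>; equality of functions is equality on \<open>carrier G\<close>.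
\<close>

definition is_extreme_character :: "('a, 'b) monoid_scheme \<Rightarrow> ('a \<Rightarrow> complex) \<Rightarrow> bool" where
  "is_extreme_character G \<phi> \<longleftrightarrow>
     is_character G \<phi> \<and>
     (\<forall>\<chi> \<psi>. \<forall>t::real. is_character G \<chi> \<longrightarrow> is_character G \<psi> \<longrightarrow> 0 < t \<longrightarrow> t < 1 \<longrightarrow>
        (\<forall>g\<in>carrier G. \<phi> g = of_real (1 - t) * \<chi> g + of_real t * \<psi> g) \<longrightarrow>
        (\<forall>g\<in>carrier G. \<chi> g = \<psi> g))"

end

theory Submission
  imports Defs
begin

text \<open>
  Every \<open>\<sigma>\<close> in \<open>B(n + 1)\<close> is uniquely \<open>r\<^sub>j \<circ> \<rho>\<close> with \<open>\<rho>\<close> in \<open>B(n)\<close> and \<open>r\<^sub>j\<close> the signed transposition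
  taking \<open>n + 1\<close> to \<open>j\<close>. Counting orbits shows that \<open>\<phi>(r\<^sub>j \<circ> \<rho>)\<close> is \<open>\<phi>(\<rho>)\<close> times \<open>1\<close> (if \<open>j = n + 1\<close>),
  \<open>q\<^sub>-\<close> (if \<open>j = -(n + 1)\<close>) or \<open>q\<^sub>+\<close> (otherwise). This recursion determines \<open>\<phi>\<close>, makes it multiplicative
  on permutations with disjoint supports, and gives
  \<open>\<Sum>\<^sub>\<sigma> \<phi>(\<sigma>) = \<Prod>\<^sub>k (1 + q\<^sub>- + 2 k q\<^sub>+)\<close> over \<open>k < n\<close>.

  Necessity: testing positivity against the four linear characters of \<open>B(n)\<close>, which change the signs of
  \<open>q\<^sub>+\<close> and \<open>q\<^sub>-\<close>, gives \<open>\<Prod>\<^sub>k (1 \<plusminus> q\<^sub>- - 2 k \<bar>q\<^sub>+\<bar>) \<ge> 0\<close> for all \<open>n\<close>. If \<open>q\<^sub>+ \<noteq> 0\<close>, the first nonpositive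
  factor has to vanish, so \<open>1 + q\<^sub>- = 2 M \<bar>q\<^sub>+\<bar>\<close> and \<open>1 - q\<^sub>- = 2 N \<bar>q\<^sub>+\<bar>\<close>.

  Sufficiency: for \<open>q\<^sub>+ = \<epsilon> / (M + N)\<close> the recursion identifies \<open>\<phi>\<close> with the average, over all colourings
  of \<open>{1..n}\<close> by \<open>M\<close> even and \<open>N\<close> odd colours, of a linear character of the stabilizer of the
  colouring, extended by \<open>0\<close>. The case \<open>q\<^sub>+ = 0\<close> is a limit.

  Extremality: let \<open>\<phi> = (1 - t) \<chi> + t \<psi>\<close> and average \<open>N\<close> conjugates of \<open>\<sigma>\<close> with disjoint supports. By
  multiplicativity the average minus \<open>\<phi>(\<sigma>)\<close> has squared \<open>\<phi>\<close>-norm \<open>O(1 / N)\<close>, hence also squared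
  \<open>\<chi>\<close>-norm \<open>O(1 / N)\<close>, and the latter bounds \<open>\<bar>\<chi>(\<sigma>) - \<phi>(\<sigma>)\<bar>\<^sup>2\<close>.
\<close>

section \<open>Basic facts on \<open>pm_set\<close> and \<open>hyperoct\<close>\<close>

lemma finite_pm_set [simp]: "finite (pm_set n)"
  by (simp add: pm_set_def)

lemma card_pm_set: "card (pm_set n) = 2 * n"
  by (simp add: pm_set_def)

lemma pm_set_Suc: "pm_set (Suc n) = insert (int (Suc n)) (insert (- int (Suc n)) (pm_set n))"
  by (auto simp: pm_set_def)

lemma hyperoct_permutes: "\<sigma> \<in> hyperoct n \<Longrightarrow> \<sigma> permutes pm_set n"
  by (simp add: hyperoct_def)

lemma hyperoct_in_pm_set: "\<sigma> \<in> hyperoct n \<Longrightarrow> \<sigma> x \<in> pm_set n \<longleftrightarrow> x \<in> pm_set n"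
  by (simp add: hyperoct_def permutes_in_image)

lemma hyperoct_fixes: "\<sigma> \<in> hyperoct n \<Longrightarrow> x \<notin> pm_set n \<Longrightarrow> \<sigma> x = x"
  by (auto simp: hyperoct_def permutes_not_in)

lemma hyperoct_permutation: "\<sigma> \<in> hyperoct n \<Longrightarrow> permutation \<sigma>"
  using hyperoct_permutes permutation_permutes finite_pm_set by blast

lemma hyperoct_inj: "\<sigma> \<in> hyperoct n \<Longrightarrow> inj \<sigma>"
  by (meson hyperoct_permutes permutes_inj)

section \<open>Orbit counts\<close>

lemma orbit_eq_iff:
  assumes "permutation \<sigma>"
  shows "orbit \<sigma> x = orbit \<sigma> y \<longleftrightarrow> x \<in> orbit \<sigma> y"
  using assms cyclic_on_orbit' orbit_cyclic_eq3 permutation_self_in_orbit by metis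

lemma orbit_uminus:
  assumes "\<sigma> \<in> hyperoct n"
  shows "uminus ` orbit \<sigma> x = orbit \<sigma> (- x)"
  using permutation_self_in_orbit[OF hyperoct_permutation[OF assms]]
  by (rule orbit_inverse) (simp add: hyperoct_uminus[OF assms])

text \<open>Singleton orbits of fixed points are included, so the number of orbits depends on
  \<open>n\<close> and not only on the permutation.\<close>

definition orbits :: "nat \<Rightarrow> (int \<Rightarrow> int) \<Rightarrow> int set set" where
  "orbits n \<sigma> = orbit \<sigma> ` pm_set n"

definition symmetric_orbits :: "nat \<Rightarrow> (int \<Rightarrow> int) \<Rightarrow> int set set" where
  "symmetric_orbits n \<sigma> = {A \<in> orbits n \<sigma>. uminus ` A = A}"

lemma finite_orbits [simp]: "finite (orbits n \<sigma>)"
  by (simp add: orbits_def)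

lemma orbits_finite: "\<sigma> \<in> hyperoct n \<Longrightarrow> A \<in> orbits n \<sigma> \<Longrightarrow> finite A"
  by (auto simp: orbits_def intro!: finite_orbit permutation_self_in_orbit hyperoct_permutation)

lemma sum_card_orbits:
  assumes "\<sigma> \<in> hyperoct n"
  shows "sum card (orbits n \<sigma>) = 2 * n"
proof -
  have p: "permutation \<sigma>" by (rule hyperoct_permutation[OF assms])
  have "\<Union> (orbits n \<sigma>) = pm_set n"
    using permutation_self_in_orbit[OF p] permutes_orbit_subset[OF hyperoct_permutes[OF assms]]
    by (auto simp: orbits_def)
  moreover have "card (\<Union> (orbits n \<sigma>)) = sum card (orbits n \<sigma>)"
  proof (rule card_Union_disjoint)
    show "pairwise disjnt (orbits n \<sigma>)"
    proof (intro pairwiseI)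
      fix A B assume "A \<in> orbits n \<sigma>" "B \<in> orbits n \<sigma>" "A \<noteq> B"
      then obtain x y where xy: "A = orbit \<sigma> x" "B = orbit \<sigma> y" by (auto simp: orbits_def)
      have False if "z \<in> A" "z \<in> B" for z
        using that \<open>A \<noteq> B\<close> orbit_eq_iff[OF p] unfolding xy by metis
      then show "disjnt A B" by (auto simp: disjnt_def)
    qed
  qed (rule orbits_finite[OF assms])
  ultimately show ?thesis by (simp add: card_pm_set)
qed

text \<open>Recovers an orbit from its cycle, which makes the cycle factors correspond bijectively
  to the nontrivial orbits.\<close>

lemma moved_perm_restrict_orbit:
  assumes "permutation \<sigma>" "x \<in> moved \<sigma>"
  shows "moved (perm_restrict \<sigma> (orbit \<sigma> x)) = orbit \<sigma> x"
proof -
  have "\<sigma> y \<noteq> y" if "y \<in> orbit \<sigma> x" for y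
  proof
    assume "\<sigma> y = y"
    then have "orbit \<sigma> x = {y}" 
      using that orbit_eq_iff[OF assms(1)] orbit_eq_singleton_iff by metis
    with permutation_self_in_orbit[OF assms(1), of x] have "x = y" by auto
    with \<open>\<sigma> y = y\<close> assms(2) show False by (simp add: moved_def)
  qed
  then show ?thesis by (auto simp: moved_def perm_restrict_def)
qed

lemma bar_cycle_perm_restrict:
  assumes "\<sigma> \<in> hyperoct n"
  shows "bar_cycle (perm_restrict \<sigma> A) = perm_restrict \<sigma> (uminus ` A)"
proof
  fix i
  have "- i \<in> A \<longleftrightarrow> i \<in> uminus ` A" by force
  then show "bar_cycle (perm_restrict \<sigma> A) i = perm_restrict \<sigma> (uminus ` A) i"
    using hyperoct_uminus[OF assms, of i]
    by (simp add: bar_cycle_def perm_restrict_def)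
qed

text \<open>The fibres of \<open>g\<close> on \<open>P\<close> are the pairs
  \<open>{x, b x}\<close>, so each value of \<open>h\<close> is counted twice. In the applications
  \<open>b\<close> is the negation of points or of orbits.\<close>

lemma sum_pairs:
  fixes h :: "'b \<Rightarrow> nat"
  assumes "finite P" "\<And>x. x \<in> P \<Longrightarrow> b x \<in> P \<and> b x \<noteq> x"
    and "\<And>x y. x \<in> P \<Longrightarrow> y \<in> P \<Longrightarrow> g x = g y \<longleftrightarrow> y = x \<or> y = b x"
    and "\<And>x. x \<in> P \<Longrightarrow> h (g x) = k x \<and> k (b x) = k x"
  shows "(\<Sum>x\<in>P. k x) = 2 * (\<Sum>Q\<in>g ` P. h Q)"
proof -
  have "(\<Sum>x\<in>P. k x) = (\<Sum>Q\<in>g ` P. sum k {x \<in> P. g x = Q})"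
    by (rule sum.image_gen) fact
  also have "\<dots> = (\<Sum>Q\<in>g ` P. 2 * h Q)"
  proof (rule sum.cong[OF refl])
    fix Q assume "Q \<in> g ` P"
    then obtain x where x: "x \<in> P" "Q = g x" by auto
    have "{y \<in> P. g y = Q} = {x, b x}"
      using assms(2)[OF x(1)] assms(3)[OF x(1)] x by auto metis+
    then show "sum k {x \<in> P. g x = Q} = 2 * h Q"
      using not_sym[OF conjunct2[OF assms(2)[OF x(1)]]] assms(4)[OF x(1)] x by simp
  qed
  finally show ?thesis by (simp add: sum_distrib_left)
qed

lemma even_card_symmetric:
  fixes A :: "int set"
  assumes "finite A" "uminus ` A = A" "0 \<notin> A"
  shows "even (card A)"
proof -
  have u: "- x \<in> A" if "x \<in> A" for x using assms(2) that by blast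
  have "card A = (\<Sum>x\<in>A. 1)" by simp
  also have "\<dots> = 2 * (\<Sum>Q\<in>abs ` A. 1)"
    by (rule sum_pairs[where b = uminus]) (use assms u in \<open>auto simp: abs_eq_iff\<close>)
  finally show ?thesis by simp
qed

text \<open>A positive cycle of length \<open>k\<close> is a pair of orbits \<open>A\<close>,
  \<open>- A\<close> of size \<open>k\<close>, a negative cycle of length \<open>m\<close> is a
  symmetric orbit of size \<open>2 * m\<close>, and each fixed point is an orbit of its own. As all
  orbit sizes add up to \<open>2 * n\<close>, two orbit counts determine both exponents.\<close>

lemma signed_reflection_orbits:
  assumes s: "\<sigma> \<in> hyperoct n"
  shows "2 * (partition_norm (rho_plus \<sigma>) + partition_norm (rho_minus \<sigma>))
           + card (orbits n \<sigma>) + card (symmetric_orbits n \<sigma>) = 2 * n"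
    and "size (rho_minus \<sigma>) = card (symmetric_orbits n \<sigma>)"
proof -
  have p: "permutation \<sigma>" by (rule hyperoct_permutation[OF s])
  define NT where "NT = orbit \<sigma> ` moved \<sigma>"
  define L where "L = perm_restrict \<sigma>"
  define P where "P = {A \<in> NT. uminus ` A \<noteq> A}"
  have mv: "moved \<sigma> \<subseteq> pm_set n"
    using hyperoct_fixes[OF s] by (auto simp: moved_def)
  have NTsub: "NT \<subseteq> orbits n \<sigma>" using mv by (auto simp: NT_def orbits_def)
  have fin: "finite NT" using finite_subset[OF NTsub] by simp
  have bar: "bar_cycle (L A) = L (uminus ` A)" for A
    unfolding L_def by (rule bar_cycle_perm_restrict[OF s])
  have mvL: "moved (L A) = A" if "A \<in> NT" for A
    using that moved_perm_restrict_orbit[OF p] by (auto simp: NT_def L_def)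
  have inj: "L A = L B \<longleftrightarrow> A = B" if "A \<in> NT" "B \<in> NT" for A B
    using mvL that by metis
  have um: "uminus ` A \<in> NT" if A: "A \<in> NT" for A
  proof -
    from A obtain x where "x \<in> moved \<sigma>" "A = orbit \<sigma> x" by (auto simp: NT_def)
    then show ?thesis unfolding NT_def
      by (intro image_eqI[where x = "- x"])
        (auto simp: orbit_uminus[OF s] moved_def hyperoct_uminus[OF s])
  qed
  have CF: "cycle_factors \<sigma> = L ` NT"
    by (auto simp: cycle_factors_def L_def NT_def image_image)
  have disj: "A \<inter> uminus ` A = {} \<longleftrightarrow> uminus ` A \<noteq> A" if A: "A \<in> NT" for A
  proof -
    from A obtain x where x: "A = orbit \<sigma> x" by (auto simp: NT_def)
    then have x': "uminus ` A = orbit \<sigma> (- x)" by (simp add: orbit_uminus[OF s])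
    show ?thesis unfolding x' unfolding x using orbit_eq_iff[OF p] orbit_nonempty[of \<sigma>]
      by (metis disjoint_iff inf.idem)
  qed
  have nonzero: "0 \<notin> A" if "A \<in> orbits n \<sigma>" for A
    using that permutes_orbit_subset[OF hyperoct_permutes[OF s]]
    unfolding orbits_def by (force simp: pm_set_def)
  have NC: "negative_cycles \<sigma> = L ` {A \<in> NT. uminus ` A = A}"
    unfolding negative_cycles_def CF using bar um inj by auto
  \<comment> \<open>A fixed point \<open>x\<close> in \<open>pm_set n\<close> is nonzero, so its
    orbit \<open>{x}\<close> is not symmetric: every symmetric orbit is nontrivial.\<close>
  have fixed: "card A = 1 \<and> uminus ` A \<noteq> A" if A: "A \<in> orbits n \<sigma> - NT" for A
  proof -
    from A obtain x where "A = orbit \<sigma> x" "x \<in> pm_set n" "x \<notin> moved \<sigma>" 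
      by (auto simp: orbits_def NT_def)
    then have "A = {x}" "x \<noteq> 0" using orbit_eq_singleton_iff[of \<sigma> x] by (auto simp: moved_def pm_set_def)
    then show ?thesis by auto
  qed
  have sym: "{A \<in> NT. uminus ` A = A} = symmetric_orbits n \<sigma>"
    using fixed NTsub by (auto simp: symmetric_orbits_def)
  have injN: "inj_on L NT" using inj by (auto simp: inj_on_def)
  have size_minus: "size (rho_minus \<sigma>) = card (symmetric_orbits n \<sigma>)"
    unfolding rho_minus_def NC sym
    by (simp add: card_image inj_on_subset[OF injN] flip: sym)
  then show "size (rho_minus \<sigma>) = card (symmetric_orbits n \<sigma>)" .
  have ev: "even (card A)" if "A \<in> symmetric_orbits n \<sigma>" for A
    using that even_card_symmetric[of A] orbits_finite[OF s] nonzero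
    by (auto simp: symmetric_orbits_def)
  have "sum_mset (rho_minus \<sigma>) = (\<Sum>c\<in>L ` symmetric_orbits n \<sigma>. card (moved c) div 2)"
    by (simp add: rho_minus_def NC sym sum_unfold_sum_mset)
  also have "\<dots> = (\<Sum>A\<in>symmetric_orbits n \<sigma>. card A div 2)"
    by (subst sum.reindex) (auto simp: inj_on_subset[OF injN] mvL simp flip: sym)
  finally have sum_minus: "2 * sum_mset (rho_minus \<sigma>) = (\<Sum>A\<in>symmetric_orbits n \<sigma>. card A)"
    using ev by (simp add: sum_distrib_left)
  define g where "g A = {L A, L (uminus ` A)}" for A
  have PC: "positive_cycles \<sigma> = g ` P"
  proof -
    have "moved (L A) \<inter> moved (bar_cycle (L A)) = {} \<longleftrightarrow> uminus ` A \<noteq> A" if "A \<in> NT" for A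
      using disj[OF that] mvL[OF that] mvL[OF um[OF that]] by (simp add: bar)
    then have "P = {A \<in> NT. moved (L A) \<inter> moved (bar_cycle (L A)) = {}}"
      unfolding P_def by (intro Collect_cong conj_cong refl) simp
    then have "{c \<in> L ` NT. moved c \<inter> moved (bar_cycle c) = {}} = L ` P"
      by fast
    moreover have "positive_cycles \<sigma>
        = (\<lambda>c. {c, bar_cycle c}) ` {c \<in> L ` NT. moved c \<inter> moved (bar_cycle c) = {}}"
      unfolding positive_cycles_def CF by blast
    ultimately show ?thesis by (simp only: image_image g_def[abs_def] bar)
  qed
  have Pum: "uminus ` A \<in> P \<and> uminus ` A \<noteq> A" if "A \<in> P" for A
    using that um by (auto simp: P_def image_image)
  have geq: "g A = g B \<longleftrightarrow> B = A \<or> B = uminus ` A" if "A \<in> P" "B \<in> P" for A B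
    using that um inj by (auto simp: g_def P_def doubleton_eq_iff image_image)
  have cardu: "card (uminus ` A) = card A" for A :: "int set"
    by (simp add: card_image)
  have lens: "the_elem ((\<lambda>c. card (moved c)) ` g A) = card A" if "A \<in> P" for A
    using that mvL um cardu by (auto simp: g_def P_def)
  have finP: "finite P" using fin by (simp add: P_def)
  have "(\<Sum>A\<in>P. card A) = 2 * (\<Sum>Q\<in>g ` P. the_elem ((\<lambda>c. card (moved c)) ` Q))"
    by (rule sum_pairs[where b = "image uminus"]) (use finP Pum geq lens cardu in auto)
  then have sum_plus: "2 * sum_mset (rho_plus \<sigma>) = (\<Sum>A\<in>P. card A)"
    by (simp add: rho_plus_def PC sum_unfold_sum_mset)
  have "(\<Sum>A\<in>P. 1 :: nat) = 2 * (\<Sum>Q\<in>g ` P. 1)"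
    by (rule sum_pairs[where b = "image uminus"]) (use finP Pum geq in auto)
  then have size_plus: "2 * size (rho_plus \<sigma>) = card P"
    by (simp add: rho_plus_def PC)
  \<comment> \<open>The lower bounds on orbit sizes, here 1 and below 2 for symmetric orbits, ensure
    that the subtraction in \<open>partition_norm\<close> does not truncate.\<close>
  have card1: "card A \<ge> 1" if "A \<in> orbits n \<sigma>" for A
    using orbits_finite[OF s that] that orbit_nonempty[of \<sigma>]
    by (auto simp: orbits_def Suc_le_eq card_gt_0_iff)
  have "card P \<le> (\<Sum>A\<in>P. card A)"
    using sum_mono[of P "\<lambda>_. 1" card] card1 NTsub by (auto simp: P_def)
  then have plus: "2 * partition_norm (rho_plus \<sigma>) + card P = (\<Sum>A\<in>P. card A)"
    using sum_plus size_plus unfolding partition_norm_def by linarith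
  have card2: "card A \<ge> 2" if "A \<in> symmetric_orbits n \<sigma>" for A
    using ev[OF that] card1[of A] that by (cases "card A = 1") (auto simp: symmetric_orbits_def)
  have "2 * card (symmetric_orbits n \<sigma>) \<le> (\<Sum>A\<in>symmetric_orbits n \<sigma>. card A)"
    using sum_mono[of "symmetric_orbits n \<sigma>" "\<lambda>_. 2" card] card2 by simp
  then have minus: "2 * partition_norm (rho_minus \<sigma>) + 2 * card (symmetric_orbits n \<sigma>)
      = (\<Sum>A\<in>symmetric_orbits n \<sigma>. card A)"
    using sum_minus size_minus unfolding partition_norm_def by linarith
  have split: "NT = P \<union> symmetric_orbits n \<sigma>" "P \<inter> symmetric_orbits n \<sigma> = {}"
    using sym by (auto simp: P_def)
  have fins: "finite (symmetric_orbits n \<sigma>)" using fin split by simp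
  have "(\<Sum>A\<in>NT. card A) = (\<Sum>A\<in>P. card A) + (\<Sum>A\<in>symmetric_orbits n \<sigma>. card A)"
    unfolding split(1) by (rule sum.union_disjoint) (use finP fins split in auto)
  moreover have "card NT = card P + card (symmetric_orbits n \<sigma>)"
    unfolding split(1) by (rule card_Un_disjoint) (use finP fins split in auto)
  moreover have "(\<Sum>A\<in>orbits n \<sigma>. card A) = (\<Sum>A\<in>NT. card A) + card (orbits n \<sigma> - NT)"
    using sum.subset_diff[OF NTsub, of card] fixed by simp
  moreover have "card (orbits n \<sigma> - NT) + card NT = card (orbits n \<sigma>)"
    using card_Diff_subset[OF fin NTsub] card_mono[OF _ NTsub] by simp
  ultimately show "2 * (partition_norm (rho_plus \<sigma>) + partition_norm (rho_minus \<sigma>))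
           + card (orbits n \<sigma>) + card (symmetric_orbits n \<sigma>) = 2 * n"
    using plus minus sum_card_orbits[OF s] unfolding distrib_left by arith
qed

section \<open>Invariance under conjugation\<close>

lemma orbit_conjugate:
  assumes "permutation \<sigma>" "bij h"
  shows "orbit (h \<circ> \<sigma> \<circ> inv_into UNIV h) (h x) = h ` orbit \<sigma> x"
  using permutation_self_in_orbit[OF assms(1)] assms(2)
  by (intro orbit_inverse[symmetric]) (auto simp: bij_is_inj)

lemma signed_reflection_cong:
  assumes "\<sigma> \<in> hyperoct n" "\<tau> \<in> hyperoct n"
    and "card (orbits n \<sigma>) = card (orbits n \<tau>)"
    and "card (symmetric_orbits n \<sigma>) = card (symmetric_orbits n \<tau>)"
  shows "signed_reflection qp qm \<sigma> = signed_reflection qp qm \<tau>"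
proof -
  have "partition_norm (rho_plus \<sigma>) + partition_norm (rho_minus \<sigma>)
      = partition_norm (rho_plus \<tau>) + partition_norm (rho_minus \<tau>)"
    using signed_reflection_orbits(1)[OF assms(1)] signed_reflection_orbits(1)[OF assms(2)] assms(3,4)
    unfolding distrib_left by arith
  then show ?thesis
    using signed_reflection_orbits(2)[OF assms(1)] signed_reflection_orbits(2)[OF assms(2)] assms(4)
    by (simp add: signed_reflection_def)
qed

lemma Collect_image: "{y \<in> f ` A. P y} = f ` {x \<in> A. P (f x)}"
  by blast

text \<open>Orbits of the conjugate are the images of orbits under \<open>h\<close>; as
  \<open>h\<close> commutes with negation, symmetric orbits correspond to symmetric ones.\<close>

lemma signed_reflection_conjugate:
  assumes s: "\<sigma> \<in> hyperoct n" and h: "h \<in> hyperoct n"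
  shows "signed_reflection qp qm (h \<circ> \<sigma> \<circ> inv_into UNIV h) = signed_reflection qp qm \<sigma>"
proof (rule signed_reflection_cong)
  let ?t = "h \<circ> \<sigma> \<circ> inv_into UNIV h"
  have b: "bij h" using hyperoct_permutes[OF h] permutes_bij by blast
  have img: "h ` pm_set n = pm_set n" using hyperoct_permutes[OF h] permutes_image by blast
  have "orbits n ?t = orbit ?t ` h ` pm_set n" by (simp add: orbits_def img)
  also have "\<dots> = image h ` orbits n \<sigma>"
    by (simp add: image_image orbit_conjugate[OF hyperoct_permutation[OF s] b] orbits_def del: o_apply)
  finally have orb: "orbits n ?t = image h ` orbits n \<sigma>" .
  have inj: "inj_on (image h) X" for X
    using b by (auto simp: inj_on_def bij_def inj_image_eq_iff)
  show "card (orbits n ?t) = card (orbits n \<sigma>)"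
    by (simp add: orb card_image[OF inj])
  have um: "uminus ` h ` A = h ` uminus ` A" for A
    by (simp add: image_image hyperoct_uminus[OF h])
  have eq: "uminus ` h ` A = h ` A \<longleftrightarrow> uminus ` A = A" for A
    using b unfolding um by (simp add: bij_is_inj inj_image_eq_iff)
  have "symmetric_orbits n ?t = image h ` symmetric_orbits n \<sigma>"
    unfolding symmetric_orbits_def orb Collect_image eq by (rule refl)
  then show "card (symmetric_orbits n ?t) = card (symmetric_orbits n \<sigma>)"
    by (simp add: card_image[OF inj])
qed (use assms hyperoct_comp hyperoct_inv in auto)

section \<open>Signed transpositions\<close>

text \<open>For \<open>a = b\<close> this is the identity, and for \<open>b = - a\<close> the sign change of the coordinate \<open>a\<close>.\<close>

definition signed_transp :: "int \<Rightarrow> int \<Rightarrow> int \<Rightarrow> int" where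
  "signed_transp a b x =
     (if x = a then b else if x = - a then - b else if x = b then a else if x = - b then - a else x)"

lemma signed_transp_involution [simp]: "a \<noteq> 0 \<Longrightarrow> b \<noteq> 0 \<Longrightarrow> signed_transp a b (signed_transp a b x) = x"
  by (auto simp: signed_transp_def)

lemma signed_transp_comp_self: "a \<noteq> 0 \<Longrightarrow> b \<noteq> 0 \<Longrightarrow> signed_transp a b \<circ> signed_transp a b = id"
  by auto

lemma signed_transp_hyperoct:
  assumes "a \<in> pm_set n" "b \<in> pm_set n"
  shows "signed_transp a b \<in> hyperoct n"
proof -
  have "signed_transp a b permutes pm_set n"
  proof (rule bij_imp_permutes)
    show "bij_betw (signed_transp a b) (pm_set n) (pm_set n)"
      by (rule bij_betw_byWitness[where f' = "signed_transp a b"])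
        (use assms in \<open>auto simp: signed_transp_def pm_set_def\<close>)
  qed (use assms pm_set_uminus in \<open>auto simp: signed_transp_def\<close>)
  moreover have "signed_transp a b (- i) = - signed_transp a b i" if "i \<in> pm_set n" for i
    using that assms by (auto simp: signed_transp_def pm_set_def)
  ultimately show ?thesis by (simp add: hyperoct_def)
qed

abbreviation reflection :: "nat \<Rightarrow> int \<Rightarrow> int \<Rightarrow> int" where
  "reflection n \<equiv> signed_transp (int (Suc n))"

lemma reflection_hyperoct: "j \<in> pm_set (Suc n) \<Longrightarrow> reflection n j \<in> hyperoct (Suc n)"
  by (rule signed_transp_hyperoct) (auto simp: pm_set_def)

lemma hyperoct_Suc: "\<sigma> \<in> hyperoct n \<Longrightarrow> \<sigma> \<in> hyperoct (Suc n)"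
  using hyperoct_mono[of n "Suc n"] by auto

lemma hyperoct_down:
  assumes "\<sigma> \<in> hyperoct (Suc n)" "\<sigma> (int (Suc n)) = int (Suc n)"
  shows "\<sigma> \<in> hyperoct n"
proof -
  have "\<sigma> x = x" if "x \<notin> pm_set n" for x
    using that hyperoct_fixes[OF assms(1), of x] hyperoct_uminus[OF assms(1), of "int (Suc n)"] assms(2)
    unfolding pm_set_Suc by auto
  then have "\<sigma> permutes pm_set n"
    using hyperoct_permutes[OF assms(1)] by (auto intro: permutes_superset)
  then show ?thesis using hyperoct_uminus[OF assms(1)] by (simp add: hyperoct_def)
qed

text \<open>The reflection exchanging \<open>n + 1\<close> with its image is an involution:
  composing once returns \<open>n + 1\<close> to itself, composing twice restores
  \<open>\<sigma>\<close>.\<close>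

lemma hyperoct_reflection_cases:
  assumes "\<sigma> \<in> hyperoct (Suc n)"
  shows "\<sigma> (int (Suc n)) \<in> pm_set (Suc n)"
    and "reflection n (\<sigma> (int (Suc n))) \<circ> \<sigma> \<in> hyperoct n"
    and "\<sigma> = reflection n (\<sigma> (int (Suc n))) \<circ> (reflection n (\<sigma> (int (Suc n))) \<circ> \<sigma>)"
proof -
  show 1: "\<sigma> (int (Suc n)) \<in> pm_set (Suc n)"
    using hyperoct_in_pm_set[OF assms] by (simp add: pm_set_def)
  show "reflection n (\<sigma> (int (Suc n))) \<circ> \<sigma> \<in> hyperoct n"
    by (rule hyperoct_down)
      (use hyperoct_comp[OF reflection_hyperoct[OF 1] assms] in \<open>auto simp: signed_transp_def\<close>)
  have "\<sigma> (int (Suc n)) \<noteq> 0" using 1 by (simp add: pm_set_def)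
  then show "\<sigma> = reflection n (\<sigma> (int (Suc n))) \<circ> (reflection n (\<sigma> (int (Suc n))) \<circ> \<sigma>)"
    using signed_transp_comp_self[of "int (Suc n)" "\<sigma> (int (Suc n))"] by (simp flip: comp_assoc)
qed

text \<open>For \<open>j\<close> in \<open>pm_set (Suc n)\<close> this is the value of
  \<open>signed_reflection qp qm\<close> at \<open>reflection n j\<close> itself: the identity, a
  negative cycle of length 1, or a positive cycle of length 2.\<close>

definition reflection_weight :: "complex \<Rightarrow> complex \<Rightarrow> nat \<Rightarrow> int \<Rightarrow> complex" where
  "reflection_weight qp qm n j = (if j = int (Suc n) then 1 else if j = - int (Suc n) then qm else qp)"

text \<open>Composing with \<open>reflection n j\<close> inserts \<open>n + 1\<close> just before
  \<open>j\<close> in its cycle and \<open>-(n + 1)\<close> just before \<open>- j\<close>. Deleting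
  the two points gives back the orbits of \<open>\<sigma>\<close>.\<close>

lemma orbit_reflection:
  assumes s: "\<sigma> \<in> hyperoct n" and j: "j \<in> pm_set n" and x: "x \<in> pm_set n"
  shows "orbit (reflection n j \<circ> \<sigma>) x \<inter> pm_set n = orbit \<sigma> x"
proof -
  let ?N = "int (Suc n)" and ?t = "reflection n j \<circ> \<sigma>"
  have N: "?N \<notin> pm_set n" "- ?N \<notin> pm_set n" by (auto simp: pm_set_def)
  note fixN = hyperoct_fixes[OF s N(1)] hyperoct_fixes[OF s N(2)]
  have ne: "j \<noteq> ?N" "j \<noteq> - ?N" "- j \<noteq> ?N" using j by (auto simp: pm_set_def)
  have tN: "?t ?N = j" "?t (- ?N) = - j"
    using fixN by (auto simp: signed_transp_def)
  \<comment> \<open>\<open>r\<close> moves the inserted points on to their successors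
    \<open>j\<close> and \<open>- j\<close>. Seen through \<open>r\<close>, a step of
    \<open>?t\<close> is a step of \<open>\<sigma>\<close> or no step at all.\<close>
  define r where "r z = (if z = ?N then j else if z = - ?N then - j else z)" for z
  have r: "r (?t z) = (if z \<in> {?N, - ?N} then r z else \<sigma> (r z))" if "z \<in> pm_set (Suc n)" for z
  proof (cases "z \<in> {?N, - ?N}")
    case True
    then show ?thesis using tN ne by (auto simp: r_def)
  next
    case False
    then have z: "\<sigma> z \<in> pm_set n" "r z = z"
      using that hyperoct_in_pm_set[OF s] by (auto simp: pm_set_Suc r_def)
    then have "\<sigma> z \<noteq> ?N" "\<sigma> z \<noteq> - ?N" using N by auto
    then show ?thesis using False z(2) ne by (auto simp: r_def signed_transp_def)
  qed
  have t: "?t \<in> hyperoct (Suc n)"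
    using hyperoct_comp[OF reflection_hyperoct hyperoct_Suc[OF s]] j by (simp add: pm_set_Suc)
  have x': "x \<in> pm_set (Suc n)" using x by (simp add: pm_set_Suc)
  have sub: "z \<in> pm_set (Suc n)" if "z \<in> orbit ?t x" for z
    using permutes_orbit_subset[OF hyperoct_permutes[OF t] x'] that by blast
  have "r z \<in> orbit \<sigma> x" if "z \<in> orbit ?t x" for z
    using that
  proof induction
    case base
    show ?case using r[OF x'] x N by (auto simp: r_def intro: orbit.base)
  next
    case (step z)
    then show ?case using r[OF sub] by (simp add: orbit.step del: o_apply)
  qed
  moreover have "r z = z" if "z \<in> pm_set n" for z using that N by (auto simp: r_def)
  ultimately have 1: "orbit ?t x \<inter> pm_set n \<subseteq> orbit \<sigma> x" by (metis IntE subsetI)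
  \<comment> \<open>Conversely, a step of \<open>\<sigma>\<close> is one step of \<open>?t\<close>,
    or two if an inserted point lies in between.\<close>
  have *: "\<sigma> z = ?t z \<or> \<sigma> z = ?t (?t z)" if "z \<in> pm_set n" for z
  proof -
    have "\<sigma> z \<noteq> ?N" "\<sigma> z \<noteq> - ?N" using hyperoct_in_pm_set[OF s] that N by metis+
    then show ?thesis using fixN ne by (auto simp: signed_transp_def)
  qed
  have "z \<in> orbit ?t x \<and> z \<in> pm_set n" if "z \<in> orbit \<sigma> x" for z
    using that
  proof induction
    case base
    show ?case using *[OF x] orbit.base[of ?t x] orbit.step[OF orbit.base, of ?t x] x
      hyperoct_in_pm_set[OF s] by metis
  next
    case (step z)
    then show ?case using *[of z] orbit.step[of _ ?t x] hyperoct_in_pm_set[OF s] by metis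
  qed
  then show ?thesis using 1 by blast
qed

text \<open>The two orbit counts decide. For \<open>j = -(n + 1)\<close> a new symmetric orbit
  raises both by one, so the exponent of \<open>qp\<close> stays and that of \<open>qm\<close> grows
  by one. For \<open>j\<close> in \<open>pm_set n\<close> both stay while \<open>n\<close> grows, so
  the exponent of \<open>qp\<close> grows by one.\<close>

lemma signed_reflection_step:
  assumes s: "\<sigma> \<in> hyperoct n" and j: "j \<in> pm_set (Suc n)"
  shows "signed_reflection qp qm (reflection n j \<circ> \<sigma>) =
    reflection_weight qp qm n j * signed_reflection qp qm \<sigma>"
proof -
  let ?N = "int (Suc n)" and ?t = "reflection n j \<circ> \<sigma>"
  have N: "?N \<notin> pm_set n" "- ?N \<notin> pm_set n" by (auto simp: pm_set_def)
  note fixN = hyperoct_fixes[OF s N(1)] hyperoct_fixes[OF s N(2)]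
  have t: "?t \<in> hyperoct (Suc n)"
    using hyperoct_comp[OF reflection_hyperoct[OF j] hyperoct_Suc[OF s]] .
  have p: "permutation ?t" by (rule hyperoct_permutation[OF t])
  note cs = signed_reflection_orbits[OF s] and ct = signed_reflection_orbits[OF t]
  let ?e = "\<lambda>\<tau>. partition_norm (rho_plus \<tau>) + partition_norm (rho_minus \<tau>)"
  consider "j = ?N" | "j = - ?N" | "j \<in> pm_set n" using j by (auto simp: pm_set_Suc)
  then show ?thesis
  proof cases
    case 1
    have "?t = \<sigma>" by (auto simp: 1 signed_transp_def)
    then show ?thesis by (simp add: reflection_weight_def 1)
  next
    case 2
    have eq: "orbit ?t x = orbit \<sigma> x" if "x \<in> pm_set n" for x
    proof (rule orbit_cong0[of _ "pm_set n", OF that, symmetric])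
      show "\<sigma> \<in> pm_set n \<rightarrow> pm_set n" using hyperoct_in_pm_set[OF s] by auto
      show "\<sigma> y = ?t y" if "y \<in> pm_set n" for y
      proof -
        have "\<sigma> y \<in> pm_set n" using that hyperoct_in_pm_set[OF s] by simp
        then have "\<sigma> y \<noteq> ?N" "\<sigma> y \<noteq> - ?N" using N by auto
        then show ?thesis by (auto simp: signed_transp_def 2)
      qed
    qed
    have tN: "?t ?N = - ?N" "?t (- ?N) = ?N"
      using fixN by (auto simp: signed_transp_def 2)
    have "orbit ?t ?N = {?N, - ?N}"
    proof
      show "orbit ?t ?N \<subseteq> {?N, - ?N}"
      proof
        fix z assume "z \<in> orbit ?t ?N"
        then show "z \<in> {?N, - ?N}" by induction (use tN in auto)
      qed
      show "{?N, - ?N} \<subseteq> orbit ?t ?N"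
        using permutation_self_in_orbit[OF p, of ?N] orbit.base[of ?t ?N] tN by simp
    qed
    moreover from this have "orbit ?t (- ?N) = {?N, - ?N}"
      using orbit_eq_iff[OF p] by blast
    ultimately have o: "orbits (Suc n) ?t = insert {?N, - ?N} (orbits n \<sigma>)"
      using image_cong[OF refl eq, of "pm_set n" "\<lambda>x. x"] unfolding orbits_def pm_set_Suc by simp
    have new: "{?N, - ?N} \<notin> orbits n \<sigma>"
      using permutes_orbit_subset[OF hyperoct_permutes[OF s]] N by (auto simp: orbits_def)
    have sy: "symmetric_orbits (Suc n) ?t = insert {?N, - ?N} (symmetric_orbits n \<sigma>)"
      unfolding symmetric_orbits_def o by auto
    have "card (orbits (Suc n) ?t) = Suc (card (orbits n \<sigma>))"
      unfolding o using new by simp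
    moreover have c: "card (symmetric_orbits (Suc n) ?t) = Suc (card (symmetric_orbits n \<sigma>))"
      unfolding sy using new by (subst card_insert_disjoint) (auto simp: symmetric_orbits_def)
    ultimately have "?e ?t = ?e \<sigma>" using cs(1) ct(1) unfolding distrib_left by presburger
    then show ?thesis unfolding signed_reflection_def cs(2) ct(2) c 
      using 2 by (simp add: reflection_weight_def)
  next
    case 3
    have eq: "orbit ?t x \<inter> pm_set n = orbit \<sigma> x" if "x \<in> pm_set n" for x
      by (rule orbit_reflection[OF s 3 that])
    \<comment> \<open>The inserted points lie in the orbits of \<open>j\<close> and
      \<open>- j\<close>, so every orbit of \<open>?t\<close> has a representative in
      \<open>pm_set n\<close>. This makes intersecting with \<open>pm_set n\<close> injective on
      orbits.\<close>
    have "j \<in> orbit ?t ?N" "- j \<in> orbit ?t (- ?N)"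
      using orbit.base[of ?t ?N] orbit.base[of ?t "- ?N"] fixN by (auto simp: signed_transp_def)
    then have "orbit ?t ?N = orbit ?t j" "orbit ?t (- ?N) = orbit ?t (- j)"
      using orbit_eq_iff[OF p] by metis+
    then have o: "orbits (Suc n) ?t = orbit ?t ` pm_set n"
      unfolding orbits_def pm_set_Suc using 3 pm_set_uminus[of j n]
      by (simp only: image_insert insert_absorb[OF imageI])
    have im: "orbits n \<sigma> = (\<lambda>A. A \<inter> pm_set n) ` orbits (Suc n) ?t"
      unfolding o unfolding image_image orbits_def by (rule image_cong[OF refl eq[symmetric]])
    have self: "x \<in> orbit ?t x" for x by (rule permutation_self_in_orbit[OF p])
    have inj: "inj_on (\<lambda>A. A \<inter> pm_set n) (orbits (Suc n) ?t)"
    proof (rule inj_onI)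
      fix A B
      assume A: "A \<in> orbits (Suc n) ?t" and B: "B \<in> orbits (Suc n) ?t"
        and AB: "A \<inter> pm_set n = B \<inter> pm_set n"
      obtain x where x: "A = orbit ?t x" "x \<in> pm_set n" using A unfolding o by (rule imageE)
      obtain y where y: "B = orbit ?t y" "y \<in> pm_set n" using B unfolding o by (rule imageE)
      have "x \<in> A" unfolding x(1) by (rule self)
      then have "x \<in> B \<inter> pm_set n" unfolding AB[symmetric] using x(2) by (rule IntI)
      then have "x \<in> orbit ?t y" unfolding y(1) by (rule IntD1)
      then show "A = B" unfolding x(1) y(1) by (rule iffD2[OF orbit_eq_iff[OF p]])
    qed
    have sym: "uminus ` (A \<inter> pm_set n) = A \<inter> pm_set n \<longleftrightarrow> uminus ` A = A" 
      if A: "A \<in> orbits (Suc n) ?t" for A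
    proof
      assume "uminus ` A = A"
      moreover have "uminus ` pm_set n = pm_set n" by (simp add: pm_set_def image_set_diff)
      ultimately show "uminus ` (A \<inter> pm_set n) = A \<inter> pm_set n"
        by (metis image_Int inj_uminus)
    next
      assume *: "uminus ` (A \<inter> pm_set n) = A \<inter> pm_set n"
      obtain x where x: "A = orbit ?t x" "x \<in> pm_set n" using A unfolding o by (rule imageE)
      have "x \<in> A" unfolding x(1) by (rule self)
      then have "x \<in> A \<inter> pm_set n" using x(2) by (rule IntI)
      then have "- x \<in> uminus ` (A \<inter> pm_set n)" by (rule imageI)
      then have "- x \<in> A \<inter> pm_set n" by (simp only: *)
      then have "- x \<in> orbit ?t x" unfolding x(1) by (rule IntD1)
      then have "orbit ?t (- x) = orbit ?t x" by (rule iffD2[OF orbit_eq_iff[OF p]])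
      then show "uminus ` A = A" unfolding x(1) orbit_uminus[OF t] .
    qed
    have "symmetric_orbits n \<sigma> = (\<lambda>A. A \<inter> pm_set n) ` symmetric_orbits (Suc n) ?t"
      unfolding symmetric_orbits_def im Collect_image
      by (intro image_cong Collect_cong conj_cong refl sym)
    then have c: "card (symmetric_orbits n \<sigma>) = card (symmetric_orbits (Suc n) ?t)"
      using card_image[OF inj_on_subset[OF inj]] by (simp add: symmetric_orbits_def)
    have "card (orbits n \<sigma>) = card (orbits (Suc n) ?t)"
      unfolding im using card_image[OF inj] .
    moreover have "a' = Suc a" if "2 * a + b + d = 2 * n" "2 * a' + b' + d' = 2 * Suc n" "b = b'" "d = d'"
      for a b d a' b' d' :: nat using that by simp
    ultimately have "?e ?t = Suc (?e \<sigma>)" using cs(1) ct(1) c by metis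
    moreover have "reflection_weight qp qm n j = qp"
      using 3 N unfolding reflection_weight_def by metis
    ultimately show ?thesis
      by (simp only: signed_reflection_def cs(2) ct(2) c power_Suc mult.assoc)
  qed
qed

section \<open>The sum over \<open>hyperoct n\<close>\<close>

lemma hyperoct_0 [simp]: "hyperoct 0 = {id}"
  by (auto simp: hyperoct_def pm_set_def)

lemma signed_reflection_id [simp]: "signed_reflection qp qm id = 1"
  using signed_reflection_orbits[of id 0]
  by (simp add: signed_reflection_def symmetric_orbits_def orbits_def pm_set_def)

lemma signed_reflection_ident [simp]: "signed_reflection qp qm (\<lambda>x. x) = 1"
  using signed_reflection_id unfolding id_def .

lemma finite_hyperoct [simp]: "finite (hyperoct n)"
  by (rule finite_subset[OF _ finite_permutations[OF finite_pm_set[of n]]]) (auto simp: hyperoct_def)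

lemma id_hyperoct [simp]: "id \<in> hyperoct n"
  by (simp add: hyperoct_def permutes_id)

lemma reflection_comp_last:
  assumes "\<rho> \<in> hyperoct n"
  shows "(reflection n j \<circ> \<rho>) (int (Suc n)) = j"
  using hyperoct_fixes[OF assms, of "int (Suc n)"] by (simp add: pm_set_def signed_transp_def)

text \<open>Since \<open>\<rho>\<close> fixes \<open>n + 1\<close>, the inverse map can read off
  \<open>j\<close> as the image of \<open>n + 1\<close> and then cancel the involution
  \<open>reflection n j\<close>.\<close>

lemma bij_betw_reflection:
  "bij_betw (\<lambda>(j, \<rho>). reflection n j \<circ> \<rho>) (pm_set (Suc n) \<times> hyperoct n) (hyperoct (Suc n))"
proof (rule bij_betw_byWitness[where f' = "\<lambda>\<sigma>. (\<sigma> (int (Suc n)), reflection n (\<sigma> (int (Suc n))) \<circ> \<sigma>)"])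
  show "\<forall>a\<in>pm_set (Suc n) \<times> hyperoct n.
     (\<lambda>\<sigma>. (\<sigma> (int (Suc n)), reflection n (\<sigma> (int (Suc n))) \<circ> \<sigma>))
       ((\<lambda>(j, \<rho>). reflection n j \<circ> \<rho>) a) = a"
  proof
    fix a assume "a \<in> pm_set (Suc n) \<times> hyperoct n"
    then obtain j \<rho> where a: "a = (j, \<rho>)" and j: "j \<in> pm_set (Suc n)" and r: "\<rho> \<in> hyperoct n"
      by blast
    have "j \<noteq> 0" using j by (simp add: pm_set_def)
    then have "reflection n j \<circ> (reflection n j \<circ> \<rho>) = \<rho>"
      using signed_transp_comp_self[of "int (Suc n)" j] by (simp flip: comp_assoc)
    then show "(\<lambda>\<sigma>. (\<sigma> (int (Suc n)), reflection n (\<sigma> (int (Suc n))) \<circ> \<sigma>))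
       ((\<lambda>(j, \<rho>). reflection n j \<circ> \<rho>) a) = a"
      by (simp only: a prod.case reflection_comp_last[OF r])
  qed
  show "\<forall>\<sigma>\<in>hyperoct (Suc n). (\<lambda>(j, \<rho>). reflection n j \<circ> \<rho>)
       (\<sigma> (int (Suc n)), reflection n (\<sigma> (int (Suc n))) \<circ> \<sigma>) = \<sigma>"
    unfolding prod.case using hyperoct_reflection_cases(3)[symmetric] by blast
  show "(\<lambda>(j, \<rho>). reflection n j \<circ> \<rho>) ` (pm_set (Suc n) \<times> hyperoct n) \<subseteq> hyperoct (Suc n)"
    using hyperoct_comp[OF reflection_hyperoct hyperoct_Suc] unfolding image_subset_iff split_paired_Ball_Sigma prod.case by blast
  show "(\<lambda>\<sigma>. (\<sigma> (int (Suc n)), reflection n (\<sigma> (int (Suc n))) \<circ> \<sigma>)) ` hyperoct (Suc n)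
      \<subseteq> pm_set (Suc n) \<times> hyperoct n"
    using hyperoct_reflection_cases(1,2) unfolding image_subset_iff by blast
qed

lemma sum_hyperoct_Suc:
  "(\<Sum>\<sigma>\<in>hyperoct (Suc n). F \<sigma>) = (\<Sum>j\<in>pm_set (Suc n). \<Sum>\<rho>\<in>hyperoct n. F (reflection n j \<circ> \<rho>))"
  by (subst sum.reindex_bij_betw[OF bij_betw_reflection, symmetric])
    (simp add: sum.cartesian_product case_prod_unfold)

lemma sum_reflection_weight:
  "(\<Sum>j\<in>pm_set (Suc n). reflection_weight qp qm n j) = 1 + qm + 2 * of_nat n * qp"
proof -
  have N: "int (Suc n) \<notin> pm_set n" "- int (Suc n) \<notin> pm_set n" by (auto simp: pm_set_def)
  have "reflection_weight qp qm n j = qp" if "j \<in> pm_set n" for j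
    using that N unfolding reflection_weight_def by metis
  then have "(\<Sum>j\<in>pm_set n. reflection_weight qp qm n j) = 2 * of_nat n * qp"
    by (simp add: card_pm_set)
  then show ?thesis
    unfolding pm_set_Suc using N
    by (subst sum.insert; simp add: sum.insert reflection_weight_def)
qed

lemma sum_signed_reflection:
  "(\<Sum>\<sigma>\<in>hyperoct n. signed_reflection qp qm \<sigma>) = (\<Prod>k<n. 1 + qm + 2 * of_nat k * qp)"
proof (induction n)
  case (Suc n)
  have "(\<Sum>\<sigma>\<in>hyperoct (Suc n). signed_reflection qp qm \<sigma>) =
    (\<Sum>j\<in>pm_set (Suc n). \<Sum>\<rho>\<in>hyperoct n. reflection_weight qp qm n j * signed_reflection qp qm \<rho>)"
    unfolding sum_hyperoct_Suc
    by (intro sum.cong refl) (rule signed_reflection_step)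
  also have "\<dots> = (1 + qm + 2 * of_nat n * qp) * (\<Sum>\<rho>\<in>hyperoct n. signed_reflection qp qm \<rho>)"
    by (simp add: sum_product flip: sum_reflection_weight)
  finally show ?case by (simp add: Suc mult.commute)
qed simp

section \<open>Multiplicativity on disjoint supports\<close>

text \<open>Induction step for \<open>\<alpha>\<close> fixing \<open>n + 1\<close>, with the
  induction hypothesis as first assumption. A reflection is split off from \<open>\<beta>\<close>
  and moved past \<open>\<alpha>\<close>, with which it commutes.\<close>

lemma signed_reflection_disjoint_aux:
  assumes "\<And>\<alpha> \<beta>. \<alpha> \<in> hyperoct n \<Longrightarrow> \<beta> \<in> hyperoct n \<Longrightarrow> (\<And>x. \<alpha> x = x \<or> \<beta> x = x) \<Longrightarrow>
      signed_reflection qp qm (\<alpha> \<circ> \<beta>) = signed_reflection qp qm \<alpha> * signed_reflection qp qm \<beta>"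
    and a: "\<alpha> \<in> hyperoct (Suc n)" and b: "\<beta> \<in> hyperoct (Suc n)"
    and d: "\<And>x. \<alpha> x = x \<or> \<beta> x = x" and last: "\<alpha> (int (Suc n)) = int (Suc n)"
  shows "signed_reflection qp qm (\<alpha> \<circ> \<beta>) = signed_reflection qp qm \<alpha> * signed_reflection qp qm \<beta>"
proof -
  let ?N = "int (Suc n)"
  define j where "j = \<beta> ?N"
  let ?r = "reflection n j"
  note cases = hyperoct_reflection_cases[OF b, folded j_def]
  have a': "\<alpha> \<in> hyperoct n" by (rule hyperoct_down[OF a last])
  have inj: "inj \<beta>" by (rule hyperoct_inj[OF b])
  \<comment> \<open>If \<open>\<alpha>\<close> moved \<open>j\<close>, then \<open>\<beta>\<close>
    would fix \<open>j\<close>, and injectivity of \<open>\<beta>\<close> would give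
    \<open>j = n + 1\<close>, a point that \<open>\<alpha>\<close> fixes.\<close>
  have "\<alpha> j = j"
    using d[of j] injD[OF inj, of j ?N] last by (auto simp: j_def)
  then have af: "\<alpha> j = j" "\<alpha> (- j) = - j" "\<alpha> (- ?N) = - ?N"
    using last hyperoct_uminus[OF a] by metis+
  have inja: "inj \<alpha>" by (rule hyperoct_inj[OF a])
  have comm: "\<alpha> \<circ> ?r = ?r \<circ> \<alpha>"
  proof
    fix x
    show "(\<alpha> \<circ> ?r) x = (?r \<circ> \<alpha>) x"
    proof (cases "x \<in> {?N, - ?N, j, - j}")
      case True
      then show ?thesis using af last by (auto simp: signed_transp_def)
    next
      case False
      then have "\<alpha> x \<notin> {?N, - ?N, j, - j}" 
        using af last injD[OF inja, of x] by (metis insert_iff empty_iff)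
      then show ?thesis using False by (auto simp: signed_transp_def)
    qed
  qed
  have b': "?r \<circ> \<beta> \<in> hyperoct n" by (rule cases(2))
  have d': "\<alpha> x = x \<or> (?r \<circ> \<beta>) x = x" for x
  proof (cases "\<alpha> x = x")
    case False
    then have "\<beta> x = x" "x \<notin> {?N, - ?N, j, - j}" using d[of x] af last by auto
    then show ?thesis by (auto simp: signed_transp_def)
  qed simp
  have "\<alpha> \<circ> \<beta> = \<alpha> \<circ> (?r \<circ> (?r \<circ> \<beta>))" using cases(3) by simp
  also have "\<dots> = ?r \<circ> (\<alpha> \<circ> (?r \<circ> \<beta>))" using comm by (metis comp_assoc)
  finally have ab: "\<alpha> \<circ> \<beta> = ?r \<circ> (\<alpha> \<circ> (?r \<circ> \<beta>))" .
  have "signed_reflection qp qm (\<alpha> \<circ> \<beta>) =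
      reflection_weight qp qm n j * (signed_reflection qp qm \<alpha> * signed_reflection qp qm (?r \<circ> \<beta>))"
    unfolding ab signed_reflection_step[OF hyperoct_comp[OF a' b'] cases(1)]
    by (subst assms(1)[OF a' b' d']) simp
  also have "\<dots> = signed_reflection qp qm \<alpha> * signed_reflection qp qm (?r \<circ> (?r \<circ> \<beta>))"
    unfolding signed_reflection_step[OF b' cases(1)] by (simp add: mult_ac)
  finally show ?thesis using cases(3) by simp
qed

lemma disjoint_comp_commute:
  assumes "inj \<alpha>" "inj \<beta>" "\<And>x. \<alpha> x = x \<or> \<beta> x = x"
  shows "\<alpha> \<circ> \<beta> = \<beta> \<circ> \<alpha>"
  using assms by (intro ext) (metis comp_apply injD)

text \<open>At least one of the two fixes \<open>n + 1\<close>. Disjoint permutations commute, so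
  their roles can be exchanged when it is \<open>\<beta>\<close>.\<close>

lemma signed_reflection_disjoint:
  assumes "\<alpha> \<in> hyperoct n" "\<beta> \<in> hyperoct n" "\<And>x. \<alpha> x = x \<or> \<beta> x = x"
  shows "signed_reflection qp qm (\<alpha> \<circ> \<beta>) = signed_reflection qp qm \<alpha> * signed_reflection qp qm \<beta>"
  using assms
proof (induction n arbitrary: \<alpha> \<beta>)
  case (Suc n)
  consider "\<alpha> (int (Suc n)) = int (Suc n)" | "\<beta> (int (Suc n)) = int (Suc n)" using Suc.prems(3) by metis
  then show ?case
  proof cases
    case 1
    show ?thesis by (rule signed_reflection_disjoint_aux[OF Suc.IH Suc.prems 1])
  next
    case 2
    have "signed_reflection qp qm (\<beta> \<circ> \<alpha>) = signed_reflection qp qm \<beta> * signed_reflection qp qm \<alpha>"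
      by (rule signed_reflection_disjoint_aux[OF Suc.IH Suc.prems(2,1) _ 2]) (use Suc.prems(3) in auto)
    moreover have "\<alpha> \<circ> \<beta> = \<beta> \<circ> \<alpha>"
      by (rule disjoint_comp_commute[OF hyperoct_inj[OF Suc.prems(1)] hyperoct_inj[OF Suc.prems(2)] Suc.prems(3)])
    ultimately show ?thesis by (simp only: mult.commute)
  qed
qed simp

section \<open>Positive definite functions\<close>

lemma hyperoct_inf_simps [simp]:
  "mult hyperoct_inf = (\<circ>)" "one hyperoct_inf = id"
  "carrier hyperoct_inf = (\<Union>n\<in>{1..}. hyperoct n)"
  by (simp_all add: hyperoct_inf_def)

lemma hyperoct_in_carrier: "\<sigma> \<in> hyperoct n \<Longrightarrow> \<sigma> \<in> carrier hyperoct_inf"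
  using hyperoct_Suc[of \<sigma> n] by (auto intro!: bexI[of _ "Suc n"])

lemma inv_hyperoct_inf:
  assumes "\<sigma> \<in> hyperoct n"
  shows "m_inv hyperoct_inf \<sigma> = inv_into UNIV \<sigma>"
  by (rule group.inv_equality[OF group_hyperoct_inf _ hyperoct_in_carrier[OF assms]
        hyperoct_in_carrier[OF hyperoct_inv[OF assms]]])
    (simp add: permutes_inv_o[OF hyperoct_permutes[OF assms]])

text \<open>The groups form a chain, so computations with finitely many elements take place in a
  single finite group.\<close>

lemma hyperoct_inf_common:
  assumes "finite A" "A \<subseteq> carrier hyperoct_inf"
  obtains n where "A \<subseteq> hyperoct n"
proof -
  from assms have "\<exists>n. A \<subseteq> hyperoct n"
  proof (induction rule: finite_induct)
    case (insert x A)
    then obtain m n where "x \<in> hyperoct m" "A \<subseteq> hyperoct n" by auto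
    then have "insert x A \<subseteq> hyperoct (max m n)"
      using hyperoct_mono[of m "max m n"] hyperoct_mono[of n "max m n"] by auto
    then show ?case by blast
  qed auto
  then show thesis using that by blast
qed

text \<open>Allows arbitrary finite index sets; \<open>bool\<close>, \<open>{0..N}\<close> and the
  group \<open>hyperoct n\<close> itself occur below.\<close>

lemma positive_definite_onD:
  assumes "positive_definite_on G \<phi>" "finite I" "g \<in> I \<rightarrow> carrier G"
  shows "(\<Sum>i\<in>I. \<Sum>j\<in>I. z i * cnj (z j) * \<phi> (inv\<^bsub>G\<^esub> (g j) \<otimes>\<^bsub>G\<^esub> g i)) \<in> \<real>\<^sub>\<ge>\<^sub>0"
proof (cases "I = {}")
  case False
  obtain e where e: "bij_betw e {1..card I} I"
    using ex_bij_betw_nat_finite_1[OF assms(2)] by blast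
  have "card I \<ge> 1" using False assms(2) by (simp add: Suc_le_eq card_gt_0_iff)
  moreover have "g \<circ> e \<in> {1..card I} \<rightarrow> carrier G"
    using assms(3) bij_betwE[OF e] by auto
  ultimately have "(\<Sum>i=1..card I. \<Sum>j=1..card I. (z \<circ> e) i * cnj ((z \<circ> e) j) *
      \<phi> (inv\<^bsub>G\<^esub> ((g \<circ> e) j) \<otimes>\<^bsub>G\<^esub> (g \<circ> e) i)) \<in> \<real>\<^sub>\<ge>\<^sub>0"
    using assms(1) unfolding positive_definite_on_def by blast
  moreover have "(\<Sum>i\<in>I. \<Sum>j\<in>I. F i j) = (\<Sum>i=1..card I. \<Sum>j=1..card I. F (e i) (e j))"
    for F :: "_ \<Rightarrow> _ \<Rightarrow> complex"
    by (simp only: sum.reindex_bij_betw[OF e, symmetric])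
  ultimately show ?thesis by (simp only: o_apply)
qed simp

text \<open>The quadratic form on the identity and \<open>g\<close> takes real values. The test
  vectors \<open>(1, 1)\<close> and \<open>(1, \<i>)\<close> yield the claim for imaginary and real
  parts respectively.\<close>

lemma positive_definite_on_inv:
  assumes "positive_definite_on G \<phi>" "group G" "g \<in> carrier G"
  shows "\<phi> (inv\<^bsub>G\<^esub> g) = cnj (\<phi> g)"
proof -
  interpret group G by fact
  define x where "x = (\<lambda>b. if b then g else \<one>\<^bsub>G\<^esub>)"
  have x: "x \<in> UNIV \<rightarrow> carrier G" using assms(3) by (auto simp: x_def)
  have *: "a * cnj a * \<phi> \<one>\<^bsub>G\<^esub> + a * cnj b * \<phi> g + (b * cnj a * \<phi> (inv\<^bsub>G\<^esub> g) + b * cnj b * \<phi> \<one>\<^bsub>G\<^esub>) \<in> \<real>\<^sub>\<ge>\<^sub>0" for a b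
    using positive_definite_onD[OF assms(1) _ x, of "\<lambda>c. if c then a else b"] assms(3)
    by (simp add: UNIV_bool x_def add_ac)
  have "Im (\<phi> \<one>\<^bsub>G\<^esub>) = 0" using *[of 1 0] by (simp add: complex_nonneg_Reals_iff)
  then show ?thesis
    using *[of 1 1] *[of 1 \<i>] by (auto simp: complex_nonneg_Reals_iff complex_eq_iff)
qed

section \<open>Characters of stabilizers of colourings\<close>

text \<open>The projection of the hyperoctahedral group onto the symmetric group that forgets
  signs.\<close>

definition abs_perm :: "(int \<Rightarrow> int) \<Rightarrow> nat \<Rightarrow> nat" where
  "abs_perm \<sigma> i = nat \<bar>\<sigma> (int i)\<bar>"

lemma abs_perm_id [simp]: "abs_perm id = id"
  by (auto simp: abs_perm_def)

lemma abs_perm_comp: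
  assumes "\<sigma> \<in> hyperoct n"
  shows "abs_perm (\<sigma> \<circ> \<tau>) = abs_perm \<sigma> \<circ> abs_perm \<tau>"
proof
  fix i
  show "abs_perm (\<sigma> \<circ> \<tau>) i = (abs_perm \<sigma> \<circ> abs_perm \<tau>) i"
    using hyperoct_uminus[OF assms, of "\<tau> (int i)"]
    by (cases "\<tau> (int i) \<ge> 0") (simp_all add: abs_perm_def)
qed

lemma abs_perm_in:
  assumes "\<sigma> \<in> hyperoct n" "i \<in> {1..n}"
  shows "abs_perm \<sigma> i \<in> {1..n}"
proof -
  have "\<sigma> (int i) \<in> pm_set n"
    using hyperoct_in_pm_set[OF assms(1)] assms(2) by (simp add: pm_set_def)
  then show ?thesis by (auto simp: abs_perm_def pm_set_def)
qed

lemma abs_perm_inverse: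
  assumes "\<sigma> \<in> hyperoct n"
  shows "abs_perm \<sigma> (abs_perm (inv_into UNIV \<sigma>) i) = i" "abs_perm (inv_into UNIV \<sigma>) (abs_perm \<sigma> i) = i"
  using abs_perm_comp[OF assms, of "inv_into UNIV \<sigma>"] abs_perm_comp[OF hyperoct_inv[OF assms], of \<sigma>]
    permutes_inv_o[OF hyperoct_permutes[OF assms]]
  by (metis abs_perm_id comp_apply id_apply)+

lemma abs_perm_permutes:
  assumes "\<sigma> \<in> hyperoct n"
  shows "abs_perm \<sigma> permutes {1..n}"
proof (rule bij_imp_permutes)
  show "bij_betw (abs_perm \<sigma>) {1..n} {1..n}"
    by (rule bij_betw_byWitness[where f' = "abs_perm (inv_into UNIV \<sigma>)"])
      (use abs_perm_inverse[OF assms] abs_perm_in[OF assms] abs_perm_in[OF hyperoct_inv[OF assms]] in blast)+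
  show "abs_perm \<sigma> i = i" if "i \<notin> {1..n}" for i
    using that hyperoct_fixes[OF assms, of "int i"] by (auto simp: abs_perm_def pm_set_def)
qed

lemma abs_perm_permutation: "\<sigma> \<in> hyperoct n \<Longrightarrow> permutation (abs_perm \<sigma>)"
  using abs_perm_permutes permutation_permutes by blast

text \<open>For \<open>\<epsilon>\<close> in \<open>{1, -1}\<close> these are the trivial and the
  sign character of the symmetric group, pulled back along \<open>abs_perm\<close>.\<close>

definition abs_sign :: "complex \<Rightarrow> (int \<Rightarrow> int) \<Rightarrow> complex" where
  "abs_sign \<epsilon> \<sigma> = (if \<epsilon> = 1 then 1 else of_int (sign (abs_perm \<sigma>)))"

lemma abs_sign_comp:
  assumes "\<sigma> \<in> hyperoct n" "\<tau> \<in> hyperoct n"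
  shows "abs_sign \<epsilon> (\<sigma> \<circ> \<tau>) = abs_sign \<epsilon> \<sigma> * abs_sign \<epsilon> \<tau>"
  using abs_perm_permutation[OF assms(1)] abs_perm_permutation[OF assms(2)]
  by (simp add: abs_sign_def abs_perm_comp[OF assms(1)] sign_compose del: o_apply)

text \<open>
  A colouring \<open>c\<close> of \<open>{1..n}\<close>, with a sign \<open>e\<close> attached to each colour, determines a linear character
  of its stabilizer in \<open>hyperoct n\<close>; this is its extension by \<open>0\<close>.
\<close>

definition stabilizes :: "nat \<Rightarrow> (nat \<Rightarrow> nat) \<Rightarrow> (int \<Rightarrow> int) \<Rightarrow> bool" where
  "stabilizes n c \<sigma> \<longleftrightarrow> (\<forall>i\<in>{1..n}. c (abs_perm \<sigma> i) = c i)"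

definition stab_char ::
  "complex \<Rightarrow> (nat \<Rightarrow> complex) \<Rightarrow> nat \<Rightarrow> (nat \<Rightarrow> nat) \<Rightarrow> (int \<Rightarrow> int) \<Rightarrow> complex" where
  "stab_char \<epsilon> e n c \<sigma> =
     (if stabilizes n c \<sigma> then abs_sign \<epsilon> \<sigma> * (\<Prod>i=1..n. if \<sigma> (int i) < 0 then e (c i) else 1) else 0)"

lemma stabilizes_comp:
  assumes "\<sigma> \<in> hyperoct n" "\<tau> \<in> hyperoct n" "stabilizes n c \<sigma>"
  shows "stabilizes n c (\<sigma> \<circ> \<tau>) \<longleftrightarrow> stabilizes n c \<tau>"
  using assms(3) abs_perm_in[OF assms(2)]
  by (simp add: stabilizes_def abs_perm_comp[OF assms(1)])

text \<open>The composite changes the sign at \<open>i\<close> iff exactly one of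
  \<open>\<tau>\<close> at \<open>i\<close> and \<open>\<sigma>\<close> at
  \<open>abs_perm \<tau> i\<close> does. Values of \<open>e\<close> square to 1 and
  \<open>\<tau>\<close> preserves colours, so the sign factors multiply after reindexing by
  \<open>abs_perm \<tau>\<close>. If \<open>\<tau>\<close> does not stabilize \<open>c\<close>, both
  sides vanish.\<close>

lemma stab_char_comp:
  assumes s: "\<sigma> \<in> hyperoct n" and t: "\<tau> \<in> hyperoct n" and st: "stabilizes n c \<sigma>"
    and e: "\<And>k. e k \<in> {1, -1}"
  shows "stab_char \<epsilon> e n c (\<sigma> \<circ> \<tau>) = stab_char \<epsilon> e n c \<sigma> * stab_char \<epsilon> e n c \<tau>"
proof (cases "stabilizes n c \<tau>")
  case True
  let ?h = "\<lambda>\<sigma> i. if \<sigma> (int i) < 0 then e (c i) else 1"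
  have "(\<Prod>i=1..n. ?h (\<sigma> \<circ> \<tau>) i) = (\<Prod>i=1..n. ?h \<sigma> (abs_perm \<tau> i) * ?h \<tau> i)"
  proof (rule prod.cong[OF refl])
    fix i assume i: "i \<in> {1..n}"
    have c: "c (abs_perm \<tau> i) = c i" using True i by (simp add: stabilizes_def)
    have ee: "e (c i) * e (c i) = 1" using e[of "c i"] by auto
    have "\<sigma> (\<tau> (int i)) \<in> pm_set n"
      using hyperoct_in_pm_set[OF s] hyperoct_in_pm_set[OF t] i by (simp add: pm_set_def)
    then have nz: "\<sigma> (\<tau> (int i)) \<noteq> 0" by (simp add: pm_set_def)
    show "?h (\<sigma> \<circ> \<tau>) i = ?h \<sigma> (abs_perm \<tau> i) * ?h \<tau> i"
    proof (cases "\<tau> (int i) < 0")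
      case True
      then have "int (abs_perm \<tau> i) = - \<tau> (int i)" by (simp add: abs_perm_def)
      then show ?thesis using True nz c ee hyperoct_uminus[OF s] by auto
    next
      case False
      then have "int (abs_perm \<tau> i) = \<tau> (int i)" by (simp add: abs_perm_def)
      then show ?thesis using False c by auto
    qed
  qed
  also have "\<dots> = (\<Prod>i=1..n. ?h \<sigma> (abs_perm \<tau> i)) * (\<Prod>i=1..n. ?h \<tau> i)"
    by (rule prod.distrib)
  also have "(\<Prod>i=1..n. ?h \<sigma> (abs_perm \<tau> i)) = (\<Prod>i=1..n. ?h \<sigma> i)"
    by (rule prod.reindex_bij_betw[OF permutes_imp_bij[OF abs_perm_permutes[OF t]]])
  finally show ?thesis
    using True st stabilizes_comp[OF s t st]
    by (simp add: stab_char_def abs_sign_comp[OF s t] mult_ac del: o_apply)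
next
  case False
  then show ?thesis using stabilizes_comp[OF s t st] by (simp add: stab_char_def)
qed

lemma stab_char_values:
  assumes "\<And>k. e k \<in> {1, -1}"
  shows "stab_char \<epsilon> e n c \<sigma> \<in> {0, 1, -1}"
proof -
  have "(\<Prod>i=1..m. if \<sigma> (int i) < 0 then e (c i) else 1) \<in> {1, -1}" for m
  proof (induction m)
    case (Suc m)
    then show ?case using assms[of "c (Suc m)"] by auto
  qed simp
  from this[of n] show ?thesis
    by (cases "abs_perm \<sigma>" rule: sign_cases) (auto simp: stab_char_def abs_sign_def)
qed

lemma stab_char_id [simp]: "stab_char \<epsilon> e n c id = 1"
  by (simp add: stab_char_def stabilizes_def abs_sign_def)

lemma stab_char_nonzero: "stab_char \<epsilon> e n c \<sigma> \<noteq> 0 \<Longrightarrow> stabilizes n c \<sigma>"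
  by (auto simp: stab_char_def split: if_splits)

text \<open>
  Summing \<open>\<bar>\<Sum>\<^sub>i z\<^sub>i \<chi>(x g\<^sub>i)\<bar>\<^sup>2\<close> over \<open>x\<close> gives the quadratic form of \<open>\<chi>\<close> times the order of the subgroup
  on which \<open>\<chi>\<close> does not vanish.
\<close>

lemma extended_character_positive:
  assumes val: "\<And>\<sigma>. \<sigma> \<in> hyperoct n \<Longrightarrow> \<chi> \<sigma> \<in> {0, 1, -1 :: complex}" and one: "\<chi> id = 1"
    and mult: "\<And>\<sigma> \<tau>. \<sigma> \<in> hyperoct n \<Longrightarrow> \<tau> \<in> hyperoct n \<Longrightarrow> \<chi> \<sigma> \<noteq> 0 \<Longrightarrow> \<chi> (\<sigma> \<circ> \<tau>) = \<chi> \<sigma> * \<chi> \<tau>"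
    and I: "g \<in> I \<rightarrow> hyperoct n"
  shows "(\<Sum>i\<in>I. \<Sum>j\<in>I. z i * cnj (z j) * \<chi> (inv_into UNIV (g j) \<circ> g i)) \<in> \<real>\<^sub>\<ge>\<^sub>0"
proof -
  let ?B = "hyperoct n" and ?S = "\<Sum>i\<in>I. \<Sum>j\<in>I. z i * cnj (z j) * \<chi> (inv_into UNIV (g j) \<circ> g i)"
  define K where "K = (\<Sum>x\<in>?B. (cmod (\<chi> x))\<^sup>2)"
  have "K \<ge> (cmod (\<chi> id))\<^sup>2"
    unfolding K_def by (rule member_le_sum[OF id_hyperoct]) auto
  then have K: "K > 0" by (simp add: one)
  have real: "cnj (\<chi> x) = \<chi> x" "\<chi> x * \<chi> x = of_real ((cmod (\<chi> x))\<^sup>2)" if "x \<in> ?B" for x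
    using val[OF that] by auto
  have corr: "(\<Sum>x\<in>?B. \<chi> (x \<circ> g i) * \<chi> (x \<circ> g j)) = of_real K * \<chi> (inv_into UNIV (g j) \<circ> g i)"
    if ij: "i \<in> I" "j \<in> I" for i j
  proof -
    have gi: "g i \<in> ?B" and gj: "g j \<in> ?B" using I ij by auto
    have inv: "g j \<circ> inv_into UNIV (g j) = id" "inv_into UNIV (g j) \<circ> g j = id"
      using permutes_inv_o[OF hyperoct_permutes[OF gj]] by auto
    \<comment> \<open>Substituting \<open>y \<circ> inv_into UNIV (g j)\<close> for \<open>x\<close>
      turns the second factor into \<open>\<chi> y\<close>. Where this is nonzero, multiplicativity
      splits \<open>\<chi> y\<close> off the first factor as well.\<close>
    have "bij_betw (\<lambda>y. y \<circ> inv_into UNIV (g j)) ?B ?B"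
      by (rule bij_betw_byWitness[where f' = "\<lambda>y. y \<circ> g j"])
        (use gj hyperoct_inv[OF gj] hyperoct_comp inv in \<open>auto simp: comp_assoc\<close>)
    then have "(\<Sum>x\<in>?B. \<chi> (x \<circ> g i) * \<chi> (x \<circ> g j)) =
        (\<Sum>y\<in>?B. \<chi> (y \<circ> inv_into UNIV (g j) \<circ> g i) * \<chi> (y \<circ> inv_into UNIV (g j) \<circ> g j))"
      by (rule sum.reindex_bij_betw[symmetric])
    also have "\<dots> = (\<Sum>y\<in>?B. of_real ((cmod (\<chi> y))\<^sup>2) * \<chi> (inv_into UNIV (g j) \<circ> g i))"
    proof (rule sum.cong[OF refl])
      fix y assume y: "y \<in> ?B"
      have 1: "y \<circ> inv_into UNIV (g j) \<circ> g j = y" using inv(2) by (simp only: comp_assoc comp_id)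
      show "\<chi> (y \<circ> inv_into UNIV (g j) \<circ> g i) * \<chi> (y \<circ> inv_into UNIV (g j) \<circ> g j)
          = of_real ((cmod (\<chi> y))\<^sup>2) * \<chi> (inv_into UNIV (g j) \<circ> g i)"
      proof (cases "\<chi> y = 0")
        case False
        then show ?thesis
          using mult[OF y hyperoct_comp[OF hyperoct_inv[OF gj] gi]] real(2)[OF y, symmetric]
          unfolding 1 by (simp add: comp_assoc)
      qed (simp add: 1)
    qed
    finally show ?thesis by (simp add: K_def sum_distrib_right)
  qed
  have "of_real K * ?S = (\<Sum>i\<in>I. \<Sum>j\<in>I. z i * cnj (z j) * (of_real K * \<chi> (inv_into UNIV (g j) \<circ> g i)))"
    by (simp add: sum_distrib_left mult_ac)
  also have "\<dots> = (\<Sum>i\<in>I. \<Sum>j\<in>I. \<Sum>x\<in>?B. z i * cnj (z j) * (\<chi> (x \<circ> g i) * \<chi> (x \<circ> g j)))"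
    by (simp add: corr[symmetric] sum_distrib_left)
  also have "\<dots> = (\<Sum>x\<in>?B. \<Sum>i\<in>I. \<Sum>j\<in>I. z i * cnj (z j) * (\<chi> (x \<circ> g i) * \<chi> (x \<circ> g j)))"
    by (subst (2) sum.swap) (subst sum.swap, rule refl)
  also have "\<dots> = (\<Sum>x\<in>?B. of_real ((cmod (\<Sum>i\<in>I. z i * \<chi> (x \<circ> g i)))\<^sup>2))"
  proof (rule sum.cong[OF refl])
    fix x assume x: "x \<in> ?B"
    have "(\<Sum>i\<in>I. \<Sum>j\<in>I. z i * cnj (z j) * (\<chi> (x \<circ> g i) * \<chi> (x \<circ> g j)))
        = (\<Sum>i\<in>I. \<Sum>j\<in>I. (z i * \<chi> (x \<circ> g i)) * cnj (z j * \<chi> (x \<circ> g j)))"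
      using I hyperoct_comp[OF x] real(1) by (intro sum.cong refl) (auto simp: Pi_iff)
    also have "\<dots> = (\<Sum>i\<in>I. z i * \<chi> (x \<circ> g i)) * cnj (\<Sum>i\<in>I. z i * \<chi> (x \<circ> g i))"
      by (simp add: sum_product)
    finally show "(\<Sum>i\<in>I. \<Sum>j\<in>I. z i * cnj (z j) * (\<chi> (x \<circ> g i) * \<chi> (x \<circ> g j)))
        = of_real ((cmod (\<Sum>i\<in>I. z i * \<chi> (x \<circ> g i)))\<^sup>2)"
      unfolding complex_norm_square .
  qed
  finally have eq: "of_real K * ?S = of_real (\<Sum>x\<in>?B. (cmod (\<Sum>i\<in>I. z i * \<chi> (x \<circ> g i)))\<^sup>2)"
    by simp
  have "?S = of_real ((\<Sum>x\<in>?B. (cmod (\<Sum>i\<in>I. z i * \<chi> (x \<circ> g i)))\<^sup>2) / K)"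
    using K eq by (simp add: field_simps del: of_real_sum)
  then show ?thesis using K by (simp only: nonneg_Reals_of_real_iff) (simp add: sum_nonneg)
qed

section \<open>The recursion for \<open>stab_char\<close>\<close>

lemma prod_only_two:
  fixes f :: "nat \<Rightarrow> complex"
  assumes "finite A" "a \<in> A" "b \<in> A" "a \<noteq> b" "\<And>i. i \<in> A \<Longrightarrow> i \<noteq> a \<Longrightarrow> i \<noteq> b \<Longrightarrow> f i = 1"
  shows "prod f A = f a * f b"
proof -
  have "prod f A = prod f {a, b}"
    by (rule prod.mono_neutral_right) (use assms in auto)
  then show ?thesis using assms(4) by simp
qed

lemma abs_perm_reflection:
  assumes "j \<in> pm_set (Suc n)"
  shows "abs_perm (reflection n j) = transpose (Suc n) (nat \<bar>j\<bar>)"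
proof
  fix i
  obtain k where k: "j = int k \<or> j = - int k" by (metis int_cases2)
  then have "nat \<bar>j\<bar> = k" by auto
  then show "abs_perm (reflection n j) i = transpose (Suc n) (nat \<bar>j\<bar>) i"
    using assms k by (auto simp: abs_perm_def signed_transp_def transpose_def pm_set_def)
qed

text \<open>In the last case the permutation swaps \<open>n + 1\<close> and some \<open>k\<close> in
  \<open>{1..n}\<close> up to sign. Signs change at both points or at neither, and for equal colours
  the two values of \<open>e\<close> cancel, leaving the factor \<open>\<epsilon>\<close> of a
  transposition.\<close>

lemma stab_char_reflection:
  assumes j: "j \<in> pm_set (Suc n)" and e: "\<And>k. e k \<in> {1, -1}" and \<epsilon>: "\<epsilon> \<in> {1, -1}"
  shows "stab_char \<epsilon> e (Suc n) c (reflection n j) =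
    (if j = int (Suc n) then 1 else if j = - int (Suc n) then e (c (Suc n))
     else if c (nat \<bar>j\<bar>) = c (Suc n) then \<epsilon> else 0)"
proof -
  let ?N = "Suc n" and ?r = "reflection n j"
  note ap = abs_perm_reflection[OF j]
  let ?h = "\<lambda>i. if ?r (int i) < 0 then e (c i) else 1"
  consider "j = int ?N" | "j = - int ?N" | "j \<noteq> int ?N" "j \<noteq> - int ?N" by blast
  then show ?thesis
  proof cases
    case 1
    then have "?r = id" by (auto simp: signed_transp_def)
    then show ?thesis using 1 by simp
  next
    case 2
    then have "nat \<bar>j\<bar> = ?N" by (simp only: abs_minus_cancel abs_of_nat nat_int)
    then have "abs_perm ?r = id" unfolding ap by simp
    moreover have "(\<Prod>i=1..?N. ?h i) = e (c ?N)"
    proof -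
      have "(\<Prod>i=1..?N. ?h i) = (\<Prod>i\<in>{?N}. ?h i)"
        by (rule prod.mono_neutral_right) (use 2 in \<open>auto simp: signed_transp_def\<close>)
      then show ?thesis using 2 by (simp add: signed_transp_def)
    qed
    ultimately show ?thesis using 2
      by (simp add: stab_char_def stabilizes_def abs_sign_def del: prod.cl_ivl_Suc)
  next
    case 3
    define k where "k = nat \<bar>j\<bar>"
    have k: "k \<in> {1..n}" "j = int k \<or> j = - int k" using j 3 by (auto simp: k_def pm_set_def)
    have st: "stabilizes ?N c ?r \<longleftrightarrow> c k = c ?N"
      unfolding stabilizes_def ap k_def[symmetric] using k by (auto simp: transpose_def)
    have "(\<Prod>i=1..?N. ?h i) = 1" if "c k = c ?N"
    proof -
      have "(\<Prod>i=1..?N. ?h i) = ?h k * ?h ?N"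
        by (rule prod_only_two) (use k in \<open>auto simp: signed_transp_def\<close>)
      also have "\<dots> = 1" using k that e[of "c k"] by (auto simp: signed_transp_def)
      finally show ?thesis .
    qed
    moreover have "abs_sign \<epsilon> ?r = \<epsilon>"
      using \<epsilon> k unfolding abs_sign_def ap k_def[symmetric] by (auto simp: sign_swap_id)
    ultimately show ?thesis using 3
      by (cases "c k = c ?N")
        (simp_all only: stab_char_def st k_def[symmetric] if_True if_False mult_1_right simp_thms)
  qed
qed

text \<open>\<open>\<rho>\<close> fixes \<open>n + 1\<close>, so the colour of this point imposes no
  condition and contributes no sign.\<close>

lemma stab_char_Suc:
  assumes "\<rho> \<in> hyperoct n"
  shows "stab_char \<epsilon> e (Suc n) (c(Suc n := k)) \<rho> = stab_char \<epsilon> e n c \<rho>"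
proof -
  have N: "\<rho> (int (Suc n)) = int (Suc n)"
    by (rule hyperoct_fixes[OF assms]) (simp add: pm_set_def)
  then have "abs_perm \<rho> (Suc n) = Suc n" by (simp only: abs_perm_def abs_of_nat nat_int)
  moreover have "abs_perm \<rho> i \<noteq> Suc n" if "i \<in> {1..n}" for i
    using abs_perm_in[OF assms that] by auto
  ultimately have "stabilizes (Suc n) (c(Suc n := k)) \<rho> = stabilizes n c \<rho>"
    by (auto simp: stabilizes_def atLeastAtMostSuc_conv)
  moreover have "(\<Prod>i=1..Suc n. if \<rho> (int i) < 0 then e ((c(Suc n := k)) i) else 1)
      = (\<Prod>i=1..n. if \<rho> (int i) < 0 then e (c i) else 1)"
  proof -
    have "(\<Prod>i=1..n. if \<rho> (int i) < 0 then e ((c(Suc n := k)) i) else 1)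
        = (\<Prod>i=1..n. if \<rho> (int i) < 0 then e (c i) else 1)"
      by (rule prod.cong) auto
    then show ?thesis using N by (simp add: prod.cl_ivl_Suc)
  qed
  ultimately show ?thesis by (simp only: stab_char_def)
qed

text \<open>Both the reflection and the composite take \<open>n + 1\<close> to \<open>j\<close>. If
  the composite stabilizes \<open>c\<close>, then \<open>n + 1\<close> and
  \<open>\<bar>j\<bar>\<close> have the same colour and the reflection stabilizes \<open>c\<close>
  too. So both sides vanish when the reflection does not.\<close>

lemma stab_char_reflection_comp:
  assumes r: "\<rho> \<in> hyperoct n" and j: "j \<in> pm_set (Suc n)"
    and e: "\<And>k. e k \<in> {1, -1}"
  shows "stab_char \<epsilon> e (Suc n) c (reflection n j \<circ> \<rho>) =
    stab_char \<epsilon> e (Suc n) c (reflection n j) * stab_char \<epsilon> e (Suc n) c \<rho>"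
proof (cases "stabilizes (Suc n) c (reflection n j)")
  case True
  then show ?thesis by (rule stab_char_comp[OF reflection_hyperoct[OF j] hyperoct_Suc[OF r] _ e])
next
  case False
  have "\<not> stabilizes (Suc n) c (reflection n j \<circ> \<rho>)"
  proof
    assume "stabilizes (Suc n) c (reflection n j \<circ> \<rho>)"
    then have "c (abs_perm (reflection n j \<circ> \<rho>) (Suc n)) = c (Suc n)"
      by (auto simp: stabilizes_def)
    then have "c (nat \<bar>j\<bar>) = c (Suc n)"
      unfolding abs_perm_def reflection_comp_last[OF r] .
    then have "stabilizes (Suc n) c (reflection n j)"
      unfolding stabilizes_def abs_perm_reflection[OF j] by (auto simp: transpose_def)
    then show False using False by simp
  qed
  then show ?thesis using False by (simp add: stab_char_def)
qed

lemma sum_PiE_Suc: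
  "(\<Sum>c\<in>{1..Suc n} \<rightarrow>\<^sub>E A. F c) = (\<Sum>c\<in>{1..n} \<rightarrow>\<^sub>E A. \<Sum>k\<in>A. F (c(Suc n := k)))"
proof -
  have "{1..Suc n} \<rightarrow>\<^sub>E A = (\<lambda>(k, c). c(Suc n := k)) ` (A \<times> ({1..n} \<rightarrow>\<^sub>E A))"
    by (simp add: atLeastAtMostSuc_conv PiE_insert_eq)
  moreover have inj: "inj_on (\<lambda>(k, c). c(Suc n := k)) (A \<times> ({1..n} \<rightarrow>\<^sub>E A))"
    by (rule inj_combinator) simp
  ultimately have "(\<Sum>c\<in>{1..Suc n} \<rightarrow>\<^sub>E A. F c) = (\<Sum>(k, c)\<in>A \<times> ({1..n} \<rightarrow>\<^sub>E A). F (c(Suc n := k)))"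
    by (simp only: sum.reindex[OF inj]) (simp add: case_prod_unfold)
  then show ?thesis by (simp add: sum.cartesian_product[symmetric] sum.swap[of _ _ A])
qed

text \<open>Both sides satisfy the same recursion. Summing over the colour of \<open>n + 1\<close>
  gives \<open>d\<close> for \<open>j = n + 1\<close>, the sum of the \<open>e k\<close> for
  \<open>j = -(n + 1)\<close>, and \<open>\<epsilon>\<close> otherwise, since exactly one of the
  \<open>d\<close> colours is that of \<open>\<bar>j\<bar>\<close>. These are \<open>d\<close> times
  the reflection weights.\<close>

lemma sum_stab_char:
  assumes e: "\<And>k. e k \<in> {1, -1}" and \<epsilon>: "\<epsilon> \<in> {1, -1}" and d: "d > 0" and s: "\<sigma> \<in> hyperoct n"
  shows "(\<Sum>c\<in>{1..n} \<rightarrow>\<^sub>E {..<d}. stab_char \<epsilon> e n c \<sigma>) =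
    of_nat d ^ n * signed_reflection (\<epsilon> / of_nat d) ((\<Sum>k<d. e k) / of_nat d) \<sigma>"
  using s
proof (induction n arbitrary: \<sigma>)
  case 0
  then show ?case by (simp flip: id_def)
next
  case (Suc n)
  define j where "j = \<sigma> (int (Suc n))"
  define \<rho> where "\<rho> = reflection n j \<circ> \<sigma>"
  note cases = hyperoct_reflection_cases[OF Suc.prems, folded j_def, folded \<rho>_def]
  let ?qp = "\<epsilon> / of_nat d" and ?qm = "(\<Sum>k<d. e k) / of_nat d"
  have inner: "(\<Sum>k<d. stab_char \<epsilon> e (Suc n) (c(Suc n := k)) \<sigma>) =
      of_nat d * reflection_weight ?qp ?qm n j * stab_char \<epsilon> e n c \<rho>"
    if c: "c \<in> {1..n} \<rightarrow>\<^sub>E {..<d}" for c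
  proof -
    have "(\<Sum>k<d. stab_char \<epsilon> e (Suc n) (c(Suc n := k)) \<sigma>)
        = (\<Sum>k<d. stab_char \<epsilon> e (Suc n) (c(Suc n := k)) (reflection n j)) * stab_char \<epsilon> e n c \<rho>"
      unfolding cases(3) stab_char_reflection_comp[OF cases(2,1) e] stab_char_Suc[OF cases(2)]
      by (rule sum_distrib_right[symmetric])
    moreover have "(\<Sum>k<d. stab_char \<epsilon> e (Suc n) (c(Suc n := k)) (reflection n j))
        = of_nat d * reflection_weight ?qp ?qm n j"
    proof -
      consider "j = int (Suc n)" | "j = - int (Suc n)" | "j \<noteq> int (Suc n)" "j \<noteq> - int (Suc n)" by blast
      then show ?thesis
      proof cases
        case 3
        have j: "nat \<bar>j\<bar> \<in> {1..n}" using cases(1) 3 by (auto simp: pm_set_def)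
        then have "c (nat \<bar>j\<bar>) \<in> {..<d}" using c by blast
        then show ?thesis using 3 j d
          unfolding stab_char_reflection[OF cases(1) e \<epsilon>] reflection_weight_def
          by simp
      next
        case 1
        then show ?thesis using d
          unfolding stab_char_reflection[OF cases(1) e \<epsilon>] reflection_weight_def by simp
      next
        case 2
        then have "j \<noteq> int (Suc n)" by simp
        with 2 show ?thesis using d
          unfolding stab_char_reflection[OF cases(1) e \<epsilon>] reflection_weight_def by simp
      qed
    qed
    ultimately show ?thesis by simp
  qed
  have "(\<Sum>c\<in>{1..Suc n} \<rightarrow>\<^sub>E {..<d}. stab_char \<epsilon> e (Suc n) c \<sigma>)
      = of_nat d * reflection_weight ?qp ?qm n j * (\<Sum>c\<in>{1..n} \<rightarrow>\<^sub>E {..<d}. stab_char \<epsilon> e n c \<rho>)"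
    unfolding sum_PiE_Suc sum_distrib_left by (intro sum.cong refl inner)
  also have "\<dots> = of_nat d ^ Suc n * (reflection_weight ?qp ?qm n j * signed_reflection ?qp ?qm \<rho>)"
    unfolding Suc.IH[OF cases(2)] by simp
  also have "reflection_weight ?qp ?qm n j * signed_reflection ?qp ?qm \<rho> = signed_reflection ?qp ?qm \<sigma>"
    using signed_reflection_step[OF cases(2,1)] cases(3) by simp
  finally show ?case .
qed

section \<open>Linear characters of \<open>hyperoct n\<close>\<close>

text \<open>With a single colour, the average above has one term, so \<open>\<phi>\<close> is a linear character.\<close>

lemma signed_reflection_linear:
  assumes "a \<in> {1, -1}" "b \<in> {1, -1}" "\<sigma> \<in> hyperoct n"
  shows "signed_reflection a b \<sigma> = stab_char a (\<lambda>_. b) n (\<lambda>i\<in>{1..n}. 0) \<sigma>"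
proof -
  have "{1..n} \<rightarrow>\<^sub>E {..<1} = {\<lambda>i\<in>{1..n}. 0 :: nat}"
    by (auto simp: PiE_def Pi_def extensional_def fun_eq_iff)
  then show ?thesis
    using sum_stab_char[OF _ assms(1) _ assms(3), of "\<lambda>_. b" 1] assms(2) by simp
qed

text \<open>Every element stabilizes the constant colouring, so \<open>stab_char\<close> is
  multiplicative on the whole group.\<close>

lemma signed_reflection_linear_comp:
  assumes ab: "a \<in> {1, -1}" "b \<in> {1, -1}" and s: "\<sigma> \<in> hyperoct n" and t: "\<tau> \<in> hyperoct n"
  shows "signed_reflection a b (\<sigma> \<circ> \<tau>) = signed_reflection a b \<sigma> * signed_reflection a b \<tau>"
proof -
  have "stabilizes n (\<lambda>i\<in>{1..n}. 0) \<sigma>"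
    using abs_perm_in[OF s] by (auto simp: stabilizes_def)
  then show ?thesis
    unfolding signed_reflection_linear[OF ab s] signed_reflection_linear[OF ab t]
      signed_reflection_linear[OF ab hyperoct_comp[OF s t]]
    using ab(2) by (intro stab_char_comp[OF s t]) auto
qed

lemma signed_reflection_linear_inv:
  assumes ab: "a \<in> {1, -1}" "b \<in> {1, -1}" and s: "\<sigma> \<in> hyperoct n"
  shows "signed_reflection a b (inv_into UNIV \<sigma>) = signed_reflection a b \<sigma>"
    and "signed_reflection a b \<sigma> \<in> {1, -1}"
proof -
  have "signed_reflection a b (inv_into UNIV \<sigma>) * signed_reflection a b \<sigma> = 1"
    using signed_reflection_linear_comp[OF ab hyperoct_inv[OF s] s]
      permutes_inv_o(2)[OF hyperoct_permutes[OF s]] by simp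
  moreover have "signed_reflection a b \<tau> \<in> {0, 1, -1}" if "\<tau> \<in> hyperoct n" for \<tau>
    unfolding signed_reflection_linear[OF ab that] using ab(2) by (intro stab_char_values) auto
  from this[OF s] this[OF hyperoct_inv[OF s]] calculation
  show "signed_reflection a b (inv_into UNIV \<sigma>) = signed_reflection a b \<sigma>"
    "signed_reflection a b \<sigma> \<in> {1, -1}" by auto
qed

section \<open>The signed reflection functions of the classification\<close>

lemma positive_definite_on_hyperoctI:
  assumes "\<And>n (I :: nat set) z g. finite I \<Longrightarrow> g \<in> I \<rightarrow> hyperoct n \<Longrightarrow>
    (\<Sum>i\<in>I. \<Sum>j\<in>I. z i * cnj (z j) * \<phi> (inv_into UNIV (g j) \<circ> g i)) \<in> \<real>\<^sub>\<ge>\<^sub>0"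
  shows "positive_definite_on hyperoct_inf \<phi>"
  unfolding positive_definite_on_def
proof (intro allI impI)
  fix k :: nat and z :: "nat \<Rightarrow> complex" and g
  assume g: "g \<in> {1..k} \<rightarrow> carrier hyperoct_inf"
  have "finite (g ` {1..k})" "g ` {1..k} \<subseteq> carrier hyperoct_inf" using g by auto
  then obtain n where "g ` {1..k} \<subseteq> hyperoct n" by (rule hyperoct_inf_common)
  then have gn: "g \<in> {1..k} \<rightarrow> hyperoct n" by blast
  have "(\<Sum>i=1..k. \<Sum>j=1..k. z i * cnj (z j) * \<phi> (inv\<^bsub>hyperoct_inf\<^esub> (g j) \<otimes>\<^bsub>hyperoct_inf\<^esub> g i))
      = (\<Sum>i=1..k. \<Sum>j=1..k. z i * cnj (z j) * \<phi> (inv_into UNIV (g j) \<circ> g i))"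
    by (intro sum.cong refl) (simp only: hyperoct_inf_simps inv_hyperoct_inf[OF funcset_mem[OF gn]])
  then show "(\<Sum>i=1..k. \<Sum>j=1..k. z i * cnj (z j) *
      \<phi> (inv\<^bsub>hyperoct_inf\<^esub> (g j) \<otimes>\<^bsub>hyperoct_inf\<^esub> g i)) \<in> \<real>\<^sub>\<ge>\<^sub>0"
    using assms[OF _ gn] by simp
qed

lemma positive_definite_on_hyperoctD:
  assumes "positive_definite_on hyperoct_inf \<phi>" "finite I" "g \<in> I \<rightarrow> hyperoct n"
  shows "(\<Sum>i\<in>I. \<Sum>j\<in>I. z i * cnj (z j) * \<phi> (inv_into UNIV (g j) \<circ> g i)) \<in> \<real>\<^sub>\<ge>\<^sub>0"
proof -
  have "g \<in> I \<rightarrow> carrier hyperoct_inf" using assms(3) hyperoct_in_carrier by blast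
  from positive_definite_onD[OF assms(1,2) this, of z]
  have "(\<Sum>i\<in>I. \<Sum>j\<in>I. z i * cnj (z j) *
      \<phi> (inv\<^bsub>hyperoct_inf\<^esub> (g j) \<otimes>\<^bsub>hyperoct_inf\<^esub> g i)) \<in> \<real>\<^sub>\<ge>\<^sub>0" .
  also have "(\<Sum>i\<in>I. \<Sum>j\<in>I. z i * cnj (z j) * \<phi> (inv\<^bsub>hyperoct_inf\<^esub> (g j) \<otimes>\<^bsub>hyperoct_inf\<^esub> g i))
      = (\<Sum>i\<in>I. \<Sum>j\<in>I. z i * cnj (z j) * \<phi> (inv_into UNIV (g j) \<circ> g i))"
    by (intro sum.cong refl) (simp only: hyperoct_inf_simps inv_hyperoct_inf[OF funcset_mem[OF assms(3)]])
  finally show ?thesis .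
qed

lemma sum_if_less:
  assumes "M \<le> d"
  shows "(\<Sum>k<d. if k < M then 1 else - 1 :: complex) = of_nat M - of_nat (d - M)"
proof -
  have "{..<d} \<inter> {k. k < M} = {..<M}" "{..<d} \<inter> - {k. k < M} = {M..<d}" using assms by auto
  then show ?thesis by (simp add: sum.If_cases)
qed

lemma positive_definite_signed_reflection:
  assumes d: "M + N \<noteq> 0" and \<epsilon>: "\<epsilon> \<in> {1, -1}"
  shows "positive_definite_on hyperoct_inf
    (signed_reflection (\<epsilon> / of_nat (M + N)) ((of_nat M - of_nat N) / of_nat (M + N)))"
proof (rule positive_definite_on_hyperoctI)
  fix n and I :: "nat set" and z g
  assume I: "finite I" and g: "g \<in> I \<rightarrow> hyperoct n"
  let ?d = "M + N"
  \<comment> \<open>\<open>M\<close> colours of sign 1 and \<open>N\<close> of sign -1 have mean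
    sign \<open>(M - N) / (M + N)\<close>, the required second parameter.\<close>
  define e :: "nat \<Rightarrow> complex" where "e k = (if k < M then 1 else -1)" for k
  define C where "C = {1..n} \<rightarrow>\<^sub>E {..<?d}"
  let ?\<phi> = "signed_reflection (\<epsilon> / of_nat ?d) ((of_nat M - of_nat N) / of_nat ?d)"
  have e1: "e k \<in> {1, -1}" for k by (simp add: e_def)
  have se: "(\<Sum>k<?d. e k) = of_nat M - of_nat N"
    using sum_if_less[of M ?d] by (simp add: e_def)
  have eq: "of_nat ?d ^ n * ?\<phi> \<sigma> = (\<Sum>c\<in>C. stab_char \<epsilon> e n c \<sigma>)" if "\<sigma> \<in> hyperoct n" for \<sigma>
    using sum_stab_char[where e = e, OF e1 \<epsilon> _ that, of ?d] d unfolding se C_def by simp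
  let ?S = "\<lambda>\<phi>. \<Sum>i\<in>I. \<Sum>j\<in>I. z i * cnj (z j) * \<phi> (inv_into UNIV (g j) \<circ> g i)"
  have pos: "?S (stab_char \<epsilon> e n c) \<in> \<real>\<^sub>\<ge>\<^sub>0" for c
  proof (rule extended_character_positive[where \<chi> = "stab_char \<epsilon> e n c", OF _ stab_char_id _ g])
    show "stab_char \<epsilon> e n c \<sigma> \<in> {0, 1, -1}" for \<sigma> using e1 by (rule stab_char_values)
    show "stab_char \<epsilon> e n c (\<sigma> \<circ> \<tau>) = stab_char \<epsilon> e n c \<sigma> * stab_char \<epsilon> e n c \<tau>"
      if "\<sigma> \<in> hyperoct n" "\<tau> \<in> hyperoct n" "stab_char \<epsilon> e n c \<sigma> \<noteq> 0" for \<sigma> \<tau>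
      using that e1 by (intro stab_char_comp) (auto dest: stab_char_nonzero)
  qed
  have "of_nat ?d ^ n * ?S ?\<phi> =
      (\<Sum>i\<in>I. \<Sum>j\<in>I. z i * cnj (z j) * (of_nat ?d ^ n * ?\<phi> (inv_into UNIV (g j) \<circ> g i)))"
    by (simp only: sum_distrib_left mult.left_commute)
  also have "\<dots> = (\<Sum>i\<in>I. \<Sum>j\<in>I. z i * cnj (z j) * (\<Sum>c\<in>C. stab_char \<epsilon> e n c (inv_into UNIV (g j) \<circ> g i)))"
    using g by (intro sum.cong refl arg_cong2[where f = "(*)"] eq hyperoct_comp hyperoct_inv) auto
  also have "\<dots> = (\<Sum>i\<in>I. \<Sum>j\<in>I. \<Sum>c\<in>C. z i * cnj (z j) * stab_char \<epsilon> e n c (inv_into UNIV (g j) \<circ> g i))"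
    by (simp only: sum_distrib_left)
  also have "\<dots> = (\<Sum>c\<in>C. ?S (stab_char \<epsilon> e n c))"
    by (subst (2) sum.swap) (subst sum.swap, rule refl)
  also have "\<dots> \<in> \<real>\<^sub>\<ge>\<^sub>0"
    using pos by (induction C rule: infinite_finite_induct) (auto intro: nonneg_Reals_add_I)
  finally have "of_nat ?d ^ n * ?S ?\<phi> \<in> \<real>\<^sub>\<ge>\<^sub>0" .
  then have "of_nat ?d ^ n * ?S ?\<phi> / of_nat ?d ^ n \<in> \<real>\<^sub>\<ge>\<^sub>0"
    by (intro nonneg_Reals_divide_I) auto
  moreover have "of_nat ?d ^ n * ?S ?\<phi> / of_nat ?d ^ n = ?S ?\<phi>"
    by (rule nonzero_mult_div_cancel_left) (use d in \<open>simp only: power_not_zero of_nat_eq_0_iff not_False_eq_True\<close>)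
  ultimately show "?S ?\<phi> \<in> \<real>\<^sub>\<ge>\<^sub>0" by simp
qed

section \<open>The limit case \<open>qp = 0\<close>\<close>

lemma tendsto_nonneg_Reals:
  fixes f :: "nat \<Rightarrow> complex"
  assumes "f \<longlonglongrightarrow> a" "\<And>n. f n \<in> \<real>\<^sub>\<ge>\<^sub>0"
  shows "a \<in> \<real>\<^sub>\<ge>\<^sub>0"
proof -
  have "Re a \<ge> 0"
    by (rule LIMSEQ_le_const[OF tendsto_Re[OF assms(1)]]) (use assms(2) in \<open>auto simp: complex_nonneg_Reals_iff\<close>)
  moreover have "(\<lambda>n. Im (f n)) \<longlonglongrightarrow> Im a" by (rule tendsto_Im[OF assms(1)])
  then have "(\<lambda>n. 0) \<longlonglongrightarrow> Im a" using assms(2) by (simp add: complex_nonneg_Reals_iff)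
  then have "Im a = 0" by (simp add: LIMSEQ_const_iff)
  ultimately show ?thesis by (simp add: complex_nonneg_Reals_iff)
qed

text \<open>Approximates \<open>r\<close> by \<open>(M - N) / (M + N)\<close> with
  \<open>M + N = k + 1\<close>, so that \<open>1 / (M + N)\<close> tends to 0 at the same
  time.\<close>

lemma signed_ratio_tendsto:
  assumes "-1 \<le> r" "r \<le> 1"
  obtains M :: "nat \<Rightarrow> nat" where "\<And>k. M k \<le> Suc k"
    "(\<lambda>k. (real (M k) - real (Suc k - M k)) / real (Suc k)) \<longlonglongrightarrow> r"
proof -
  \<comment> \<open>\<open>x k\<close> solves \<open>(2 * x - (k + 1)) / (k + 1) = r\<close>;
    rounding it down costs at most \<open>2 / (k + 1)\<close>.\<close>
  define x where "x k = real (Suc k) * ((1 + r) / 2)" for k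
  define M where "M k = nat \<lfloor>x k\<rfloor>" for k
  have nn: "x k \<ge> 0" for k using assms by (simp add: x_def)
  have "x k \<le> real (Suc k) * 1" for k
    unfolding x_def using assms by (intro mult_left_mono) auto
  then have ub: "x k \<le> real (Suc k)" for k by simp
  have le: "M k \<le> Suc k" for k
    unfolding M_def using nn[of k] ub[of k] by linarith
  have M: "real (M k) \<le> x k" "x k \<le> real (M k) + 1" for k
    unfolding M_def using nn[of k] by linarith+
  have dev: "\<bar>(real (M k) - real (Suc k - M k)) / real (Suc k) - r\<bar> \<le> 2 * inverse (real (Suc k))" for k
  proof -
    have "(real (M k) - real (Suc k - M k)) / real (Suc k) - r
        = (2 * real (M k) - 2 * x k) / real (Suc k)"
      using le[of k] by (simp add: x_def of_nat_diff field_simps)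
    also have "\<bar>\<dots>\<bar> = \<bar>2 * real (M k) - 2 * x k\<bar> / real (Suc k)"
      by simp
    also have "\<dots> \<le> 2 / real (Suc k)"
      using M[of k] by (intro divide_right_mono) auto
    finally show ?thesis by (simp add: field_simps)
  qed
  have "(\<lambda>k. 2 * inverse (real (Suc k))) \<longlonglongrightarrow> 2 * 0"
    by (intro tendsto_intros LIMSEQ_inverse_real_of_nat)
  then have lim: "(\<lambda>k. 2 * inverse (real (Suc k))) \<longlonglongrightarrow> 0" by simp
  have bnd: "norm ((real (M k) - real (Suc k - M k)) / real (Suc k) - r)
      \<le> norm (2 * inverse (real (Suc k))) * 1" for k
    unfolding real_norm_def mult_1_right by (rule order_trans[OF dev abs_ge_self])
  have "(\<lambda>k. (real (M k) - real (Suc k - M k)) / real (Suc k) - r) \<longlonglongrightarrow> 0"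
    by (rule tendsto_0_le[OF lim always_eventually[OF allI[OF bnd]]])
  then have "(\<lambda>k. (real (M k) - real (Suc k - M k)) / real (Suc k)) \<longlonglongrightarrow> r"
    by (simp only: LIM_zero_iff)
  then show thesis by (rule that[OF le])
qed

text \<open>For fixed group elements the quadratic form is a polynomial in the two parameters, also
  at 0 because \<open>0 ^ 0 = 1\<close>. Hence positivity passes to the limit.\<close>

lemma positive_definite_signed_reflection_zero:
  assumes "-1 \<le> r" "r \<le> 1"
  shows "positive_definite_on hyperoct_inf (signed_reflection 0 (of_real r))"
  unfolding positive_definite_on_def
proof (intro allI impI)
  fix k :: nat and z :: "nat \<Rightarrow> complex" and g
  assume k: "1 \<le> k" and g: "g \<in> {1..k} \<rightarrow> carrier hyperoct_inf"
  obtain M :: "nat \<Rightarrow> nat" where le: "\<And>m. M m \<le> Suc m"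
    and lim: "(\<lambda>m. (real (M m) - real (Suc m - M m)) / real (Suc m)) \<longlonglongrightarrow> r"
    using signed_ratio_tendsto[OF assms] by blast
  let ?p = "\<lambda>m. 1 / of_nat (Suc m) :: complex"
  let ?q = "\<lambda>m. (of_nat (M m) - of_nat (Suc m - M m)) / of_nat (Suc m) :: complex"
  have p: "?p \<longlonglongrightarrow> 0"
    using tendsto_of_real[OF LIMSEQ_inverse_real_of_nat, where 'a = complex] by (simp add: field_simps)
  have "(\<lambda>m. complex_of_real ((real (M m) - real (Suc m - M m)) / real (Suc m))) \<longlonglongrightarrow> of_real r"
    by (rule tendsto_of_real[OF lim])
  then have q: "?q \<longlonglongrightarrow> of_real r" by simp
  let ?S = "\<lambda>\<phi>. \<Sum>i=1..k. \<Sum>j=1..k. z i * cnj (z j) *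
      \<phi> (inv\<^bsub>hyperoct_inf\<^esub> (g j) \<otimes>\<^bsub>hyperoct_inf\<^esub> g i)"
  have "(\<lambda>m. ?S (signed_reflection (?p m) (?q m))) \<longlonglongrightarrow> ?S (signed_reflection 0 (of_real r))"
    unfolding signed_reflection_def by (intro tendsto_intros p q)
  moreover have "?S (signed_reflection (?p m) (?q m)) \<in> \<real>\<^sub>\<ge>\<^sub>0" for m
    using positive_definite_signed_reflection[of "M m" "Suc m - M m" 1] le[of m] k g
    unfolding positive_definite_on_def by simp
  ultimately show "?S (signed_reflection 0 (of_real r)) \<in> \<real>\<^sub>\<ge>\<^sub>0"
    by (rule tendsto_nonneg_Reals)
qed

lemma central_signed_reflection: "central_on hyperoct_inf (signed_reflection qp qm)"
  unfolding central_on_def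
proof (intro ballI)
  fix g h assume gh: "g \<in> carrier hyperoct_inf" "h \<in> carrier hyperoct_inf"
  obtain n where "{g, h} \<subseteq> hyperoct n"
    using hyperoct_inf_common[of "{g, h}"] gh by auto
  then have g: "g \<in> hyperoct n" and h: "h \<in> hyperoct n" by auto
  show "signed_reflection qp qm (h \<otimes>\<^bsub>hyperoct_inf\<^esub> g \<otimes>\<^bsub>hyperoct_inf\<^esub> inv\<^bsub>hyperoct_inf\<^esub> h)
      = signed_reflection qp qm g"
    unfolding inv_hyperoct_inf[OF h] hyperoct_inf_simps by (rule signed_reflection_conjugate[OF g h])
qed

lemma is_character_signed_reflection_iff:
  "is_character hyperoct_inf (signed_reflection qp qm) \<longleftrightarrow>
   positive_definite_on hyperoct_inf (signed_reflection qp qm)"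
  by (simp add: is_character_def central_signed_reflection)

section \<open>Extremality\<close>

text \<open>Intended for \<open>0 \<le> m \<le> s\<close>: the odd involution exchanging the then
  disjoint blocks \<open>{1..m}\<close> and \<open>{s + 1..s + m}\<close>.\<close>

definition block_swap :: "int \<Rightarrow> int \<Rightarrow> int \<Rightarrow> int" where
  "block_swap m s x =
     (if 0 < x \<and> x \<le> m then x + s else if - m \<le> x \<and> x < 0 then x - s
      else if s < x \<and> x \<le> s + m then x - s else if - s - m \<le> x \<and> x < - s then x + s else x)"

lemma block_swap_involution:
  assumes "0 \<le> m" "m \<le> s"
  shows "block_swap m s (block_swap m s x) = x"
  using assms by (auto simp: block_swap_def)

lemma inv_block_swap:
  assumes "0 \<le> m" "m \<le> s"
  shows "inv_into UNIV (block_swap m s) = block_swap m s"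
  by (rule inv_unique_comp) (auto simp: block_swap_involution[OF assms])

lemma block_swap_hyperoct:
  assumes m: "0 \<le> m" "m \<le> s" and N: "int N = s + m"
  shows "block_swap m s \<in> hyperoct N"
proof -
  have "block_swap m s permutes pm_set N"
  proof (rule bij_imp_permutes)
    have "block_swap m s x \<in> pm_set N" if "x \<in> pm_set N" for x
      using that m by (auto simp: block_swap_def pm_set_def N)
    then show "bij_betw (block_swap m s) (pm_set N) (pm_set N)"
      by (intro bij_betw_byWitness[where f' = "block_swap m s"]) (auto simp: block_swap_involution[OF m])
    show "block_swap m s x = x" if "x \<notin> pm_set N" for x
      using that m by (auto simp: block_swap_def pm_set_def N)
  qed
  moreover have "block_swap m s (- x) = - block_swap m s x" for x
    using m by (auto simp: block_swap_def)
  ultimately show ?thesis by (simp add: hyperoct_def)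
qed

lemma block_swap_support:
  assumes "0 \<le> m" "m \<le> s" "block_swap m s x \<noteq> 0" "\<bar>block_swap m s x\<bar> \<le> m"
  shows "s < \<bar>x\<bar> \<and> \<bar>x\<bar> \<le> s + m"
  using assms by (auto simp: block_swap_def split: if_splits)

text \<open>
  Conjugates of \<open>\<sigma>\<close> moving only points of absolute value in \<open>{i * m<..(i + 1) * m}\<close>, hence with
  pairwise disjoint supports.
\<close>

definition block_conj :: "nat \<Rightarrow> (int \<Rightarrow> int) \<Rightarrow> nat \<Rightarrow> int \<Rightarrow> int" where
  "block_conj m \<sigma> i =
     block_swap (int m) (int (i * m)) \<circ> \<sigma> \<circ> inv_into UNIV (block_swap (int m) (int (i * m)))"

lemma block_conj_support:
  assumes s: "\<sigma> \<in> hyperoct m" and i: "i \<ge> 1" and x: "block_conj m \<sigma> i x \<noteq> x"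
  shows "int (i * m) < \<bar>x\<bar> \<and> \<bar>x\<bar> \<le> int (i * m) + int m"
proof -
  let ?b = "block_swap (int m) (int (i * m))"
  \<comment> \<open>\<open>i \<ge> 1\<close> keeps the target block disjoint from
    \<open>{1..m}\<close>; this is why the conjugates are numbered from 1.\<close>
  have m: "0 \<le> int m" "int m \<le> int (i * m)" using i by (cases i; auto)+
  have "\<sigma> (?b x) \<noteq> ?b x"
  proof
    assume "\<sigma> (?b x) = ?b x"
    then have "block_conj m \<sigma> i x = x"
      unfolding block_conj_def inv_block_swap[OF m] o_apply by (simp only: block_swap_involution[OF m])
    then show False using x by contradiction
  qed
  then have "?b x \<in> pm_set m" using hyperoct_fixes[OF s] by blast
  then have "?b x \<noteq> 0" "\<bar>?b x\<bar> \<le> int m" by (simp_all only: pm_set_def) auto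
  then show ?thesis by (rule block_swap_support[OF m])
qed

lemma block_conj_disjoint:
  assumes s: "\<sigma> \<in> hyperoct m" and "i \<ge> 1" "j \<ge> 1" "i \<noteq> j"
  shows "block_conj m \<sigma> i x = x \<or> block_conj m \<sigma> j x = x"
proof (rule ccontr)
  assume "\<not> ?thesis"
  then have a: "int (i * m) < \<bar>x\<bar>" "\<bar>x\<bar> \<le> int (i * m) + int m"
    "int (j * m) < \<bar>x\<bar>" "\<bar>x\<bar> \<le> int (j * m) + int m"
    using block_conj_support[OF s] assms(2,3) by blast+
  have "Suc i * m \<le> j * m \<or> Suc j * m \<le> i * m"
    using assms(4) by (metis Suc_leI linorder_neqE_nat mult_le_mono1)
  then have "int (i * m) + int m \<le> int (j * m) \<or> int (j * m) + int m \<le> int (i * m)"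
    by (metis add.commute mult_Suc of_nat_add of_nat_le_iff)
  then show False using a by linarith
qed

lemma block_conj_hyperoct:
  assumes s: "\<sigma> \<in> hyperoct m" and i: "i \<ge> 1"
  shows "block_conj m \<sigma> i \<in> hyperoct (i * m + m)"
    and "block_swap (int m) (int (i * m)) \<in> hyperoct (i * m + m)"
proof -
  have m: "0 \<le> int m" "int m \<le> int (i * m)" using i by (cases i; auto)+
  show b: "block_swap (int m) (int (i * m)) \<in> hyperoct (i * m + m)"
    by (rule block_swap_hyperoct[OF m]) simp
  have "\<sigma> \<in> hyperoct (i * m + m)" using hyperoct_mono[of m "i * m + m"] s by auto
  then show "block_conj m \<sigma> i \<in> hyperoct (i * m + m)"
    unfolding block_conj_def using b by (intro hyperoct_comp hyperoct_inv)
qed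

lemma character_block_conj:
  assumes f: "is_character hyperoct_inf f" and s: "\<sigma> \<in> hyperoct m" and i: "i \<ge> 1"
  shows "f (block_conj m \<sigma> i) = f \<sigma>"
proof -
  note b = block_conj_hyperoct(2)[OF s i]
  have "f (block_swap (int m) (int (i * m)) \<otimes>\<^bsub>hyperoct_inf\<^esub> \<sigma>
      \<otimes>\<^bsub>hyperoct_inf\<^esub> inv\<^bsub>hyperoct_inf\<^esub> (block_swap (int m) (int (i * m)))) = f \<sigma>"
    using f hyperoct_in_carrier[OF s] hyperoct_in_carrier[OF b]
    unfolding is_character_def central_on_def by blast
  then show ?thesis unfolding inv_hyperoct_inf[OF b] hyperoct_inf_simps block_conj_def .
qed

lemma character_inv:
  assumes "is_character hyperoct_inf f" "\<sigma> \<in> hyperoct n"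
  shows "f (inv_into UNIV \<sigma>) = cnj (f \<sigma>)"
  using positive_definite_on_inv[OF _ group_hyperoct_inf hyperoct_in_carrier[OF assms(2)], of f] assms(1)
  unfolding inv_hyperoct_inf[OF assms(2)] is_character_def by blast

text \<open>For positive definite \<open>f\<close> this is the squared norm of the sum of the
  \<open>N\<close> conjugates in the semi-inner product defined by \<open>f\<close>.\<close>

definition block_sum :: "((int \<Rightarrow> int) \<Rightarrow> complex) \<Rightarrow> nat \<Rightarrow> (int \<Rightarrow> int) \<Rightarrow> nat \<Rightarrow> complex" where
  "block_sum f m \<sigma> N =
     (\<Sum>i=1..N. \<Sum>j=1..N. f (inv_into UNIV (block_conj m \<sigma> j) \<circ> block_conj m \<sigma> i))"

text \<open>The quadratic form of \<open>f\<close> at the sum of the \<open>N\<close> conjugates of \<open>\<sigma>\<close> minus \<open>N w\<close> times the identity.\<close>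

lemma character_block_form:
  assumes f: "is_character hyperoct_inf f" and s: "\<sigma> \<in> hyperoct m"
  shows "block_sum f m \<sigma> N - of_nat N ^ 2 * (cnj w * f \<sigma> + w * cnj (f \<sigma>) - w * cnj w) \<in> \<real>\<^sub>\<ge>\<^sub>0"
proof -
  define g where "g i = (if i = 0 then id else block_conj m \<sigma> i)" for i
  define z where "z i = (if i = 0 then - of_nat N * w else 1)" for i :: nat
  have b: "block_conj m \<sigma> i \<in> hyperoct (N * m + m)" if "i \<in> {1..N}" for i
    using block_conj_hyperoct(1)[OF s, of i] that hyperoct_mono[of "i * m + m" "N * m + m"] by auto
  then have g: "g \<in> {0..N} \<rightarrow> hyperoct (N * m + m)" by (auto simp: g_def)
  let ?F = "\<lambda>i j. z i * cnj (z j) * f (inv_into UNIV (g j) \<circ> g i)"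
  have one: "f id = 1" using f by (simp add: is_character_def)
  have invid: "inv_into UNIV id = (id :: int \<Rightarrow> int)" by (rule inv_id)
  have form_00: "?F 0 0 = of_nat N ^ 2 * (w * cnj w)"
    by (simp add: z_def g_def invid one power2_eq_square del: inv_id)
  have gz: "g i = block_conj m \<sigma> i" "z i = 1" if "i \<in> {1..N}" for i
    using that by (simp_all add: g_def z_def)
  have gz0: "g 0 = id" "z 0 = - of_nat N * w" by (simp_all add: g_def z_def)
  have fb: "f (block_conj m \<sigma> i) = f \<sigma>" if "i \<in> {1..N}" for i
    using that character_block_conj[OF f s, of i] by simp
  have form_i0: "?F i 0 = - of_nat N * cnj w * f \<sigma>" if "i \<in> {1..N}" for i
    unfolding gz[OF that] gz0 invid id_comp fb[OF that] by simp
  have form_0j: "?F 0 j = - of_nat N * w * cnj (f \<sigma>)" if "j \<in> {1..N}" for j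
    unfolding gz[OF that] gz0 comp_id character_inv[OF f b[OF that]] fb[OF that] by simp
  have form_ij: "?F i j = f (inv_into UNIV (block_conj m \<sigma> j) \<circ> block_conj m \<sigma> i)"
    if "i \<in> {1..N}" "j \<in> {1..N}" for i j
    unfolding gz[OF that(1)] gz[OF that(2)] by simp
  have split: "(\<Sum>i=0..N. h i) = h 0 + (\<Sum>i=1..N. h i)" for h :: "nat \<Rightarrow> complex"
    by (simp add: sum.atLeast_Suc_atMost)
  have "(\<Sum>i=0..N. \<Sum>j=0..N. ?F i j) =
      ?F 0 0 + (\<Sum>j=1..N. ?F 0 j) + (\<Sum>i=1..N. ?F i 0 + (\<Sum>j=1..N. ?F i j))"
    by (simp only: split)
  also have "\<dots> = ?F 0 0 + (\<Sum>j=1..N. ?F 0 j) + ((\<Sum>i=1..N. ?F i 0) + (\<Sum>i=1..N. \<Sum>j=1..N. ?F i j))"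
    by (simp only: sum.distrib)
  also have "(\<Sum>j=1..N. ?F 0 j) = (\<Sum>j=1..N. - of_nat N * w * cnj (f \<sigma>))"
    by (rule sum.cong[OF refl form_0j])
  also have "(\<Sum>i=1..N. ?F i 0) = (\<Sum>i=1..N. - of_nat N * cnj w * f \<sigma>)"
    by (rule sum.cong[OF refl form_i0])
  also have "(\<Sum>i=1..N. \<Sum>j=1..N. ?F i j) = block_sum f m \<sigma> N"
    unfolding block_sum_def by (intro sum.cong refl form_ij)
  also have "?F 0 0 + (\<Sum>j=1..N. - of_nat N * w * cnj (f \<sigma>)) +
        ((\<Sum>i=1..N. - of_nat N * cnj w * f \<sigma>) + block_sum f m \<sigma> N) =
      block_sum f m \<sigma> N - of_nat N ^ 2 * (cnj w * f \<sigma> + w * cnj (f \<sigma>) - w * cnj w)"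
    unfolding form_00 by (simp add: algebra_simps power2_eq_square)
  finally have eq: "(\<Sum>i=0..N. \<Sum>j=0..N. ?F i j) =
      block_sum f m \<sigma> N - of_nat N ^ 2 * (cnj w * f \<sigma> + w * cnj (f \<sigma>) - w * cnj w)" .
  have "positive_definite_on hyperoct_inf f" using f by (simp add: is_character_def)
  from positive_definite_on_hyperoctD[OF this _ g, of z] show ?thesis unfolding eq by simp
qed

text \<open>The \<open>N\<close> diagonal entries are 1. Off the diagonal the supports are disjoint,
  so multiplicativity and centrality give the squared modulus of the value at
  \<open>\<sigma>\<close>.\<close>

lemma block_sum_signed_reflection:
  assumes f: "is_character hyperoct_inf (signed_reflection qp qm)" and s: "\<sigma> \<in> hyperoct m"
  shows "block_sum (signed_reflection qp qm) m \<sigma> N =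
    of_nat N + (of_nat N ^ 2 - of_nat N) * of_real ((cmod (signed_reflection qp qm \<sigma>))\<^sup>2)"
proof -
  let ?\<phi> = "signed_reflection qp qm" and ?b = "block_conj m \<sigma>"
  define a :: complex where "a = of_real ((cmod (?\<phi> \<sigma>))\<^sup>2)"
  have b: "?b i \<in> hyperoct (N * m + m)" if "i \<in> {1..N}" for i
    using block_conj_hyperoct(1)[OF s, of i] that hyperoct_mono[of "i * m + m" "N * m + m"] by auto
  have entry: "?\<phi> (inv_into UNIV (?b j) \<circ> ?b i) = a + (if i = j then 1 - a else 0)"
    if i: "i \<in> {1..N}" and j: "j \<in> {1..N}" for i j
  proof (cases "i = j")
    case True
    then show ?thesis using permutes_inv_o(2)[OF hyperoct_permutes[OF b[OF j]]] by simp
  next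
    case False
    have "inv_into UNIV (?b j) x = x \<or> ?b i x = x" for x
    proof -
      have "?b j x = x \<or> ?b i x = x" using block_conj_disjoint[OF s, of j i] i j False by auto
      then show ?thesis using permutes_inverses(2)[OF hyperoct_permutes[OF b[OF j]], of x] by auto
    qed
    then have "?\<phi> (inv_into UNIV (?b j) \<circ> ?b i) = ?\<phi> (inv_into UNIV (?b j)) * ?\<phi> (?b i)"
      by (rule signed_reflection_disjoint[OF hyperoct_inv[OF b[OF j]] b[OF i]])
    also have "\<dots> = a"
      using character_inv[OF f b[OF j]] character_block_conj[OF f s, of i] character_block_conj[OF f s, of j] i j
      unfolding a_def complex_norm_square by (simp add: mult.commute)
    finally show ?thesis using False by simp
  qed
  have "block_sum ?\<phi> m \<sigma> N = (\<Sum>i=1..N. \<Sum>j=1..N. a + (if i = j then 1 - a else 0))"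
    unfolding block_sum_def by (intro sum.cong refl entry)
  also have "\<dots> = of_nat N * (of_nat N * a + (1 - a))"
    by (simp add: sum.distrib)
  also have "\<dots> = of_nat N + (of_nat N ^ 2 - of_nat N) * a"
    by (simp add: algebra_simps power2_eq_square)
  finally show ?thesis unfolding a_def .
qed

text \<open>\<open>c\<close>, \<open>d\<close>, \<open>p\<close> are the values of \<phi>, \<chi>,
  \<psi> in real coordinates, \<open>X\<close> and \<open>Y\<close> the block sums of \<chi> and
  \<psi>. The bounds on \<open>X\<close> and \<open>Y\<close> come from the block form with
  \<open>w = d\<close> and \<open>w = c\<close>. Eliminating \<open>p\<close> by the convex relation
  completes a square.\<close>

lemma block_bound:
  fixes t N X Y c1 c2 d1 d2 p1 p2 :: real
  assumes t: "0 < t" "t < 1" and N: "N > 0"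
    and X: "X \<ge> N\<^sup>2 * (d1\<^sup>2 + d2\<^sup>2)"
    and Y: "Y \<ge> N\<^sup>2 * (2 * (c1 * p1 + c2 * p2) - (c1\<^sup>2 + c2\<^sup>2))"
    and Z: "(1 - t) * X + t * Y = N + (N\<^sup>2 - N) * (c1\<^sup>2 + c2\<^sup>2)"
    and c: "c1 = (1 - t) * d1 + t * p1" "c2 = (1 - t) * d2 + t * p2"
  shows "(1 - t) * N * ((d1 - c1)\<^sup>2 + (d2 - c2)\<^sup>2) \<le> 1"
proof -
  let ?C = "c1\<^sup>2 + c2\<^sup>2"
  have tp: "t * p1 = c1 - (1 - t) * d1" "t * p2 = c2 - (1 - t) * d2" using c by simp_all
  have "(1 - t) * (N\<^sup>2 * (d1\<^sup>2 + d2\<^sup>2)) + t * (N\<^sup>2 * (2 * (c1 * p1 + c2 * p2) - ?C)) \<le> (1 - t) * X + t * Y"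
    using t X Y by (intro add_mono mult_left_mono) auto
  also have "t * (N\<^sup>2 * (2 * (c1 * p1 + c2 * p2) - ?C)) =
      N\<^sup>2 * (2 * (c1 * (t * p1) + c2 * (t * p2)) - t * ?C)"
    by (simp add: algebra_simps)
  also have "(1 - t) * (N\<^sup>2 * (d1\<^sup>2 + d2\<^sup>2)) + \<dots> =
      N * ((1 - t) * N * ((d1 - c1)\<^sup>2 + (d2 - c2)\<^sup>2)) + N\<^sup>2 * ?C"
    unfolding tp by (simp add: algebra_simps power2_eq_square)
  finally have "N * ((1 - t) * N * ((d1 - c1)\<^sup>2 + (d2 - c2)\<^sup>2)) \<le> N * (1 - ?C)"
    unfolding Z by (simp add: algebra_simps)
  then have "(1 - t) * N * ((d1 - c1)\<^sup>2 + (d2 - c2)\<^sup>2) \<le> 1 - ?C" using N by simp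
  also have "\<dots> \<le> 1" by simp
  finally show ?thesis .
qed

text \<open>The distance of \<open>\<chi> g\<close> from the value of the signed reflection function
  does not depend on \<open>N\<close>, but its square is bounded by a multiple of
  \<open>1 / N\<close> for every \<open>N\<close>, so it vanishes. The convex relation then settles
  \<open>\<psi> g\<close>.\<close>

lemma signed_reflection_convex_combination:
  assumes \<phi>: "is_character hyperoct_inf (signed_reflection qp qm)"
    and \<chi>: "is_character hyperoct_inf \<chi>" and \<psi>: "is_character hyperoct_inf \<psi>"
    and t: "0 < t" "t < 1"
    and eq: "\<forall>g\<in>carrier hyperoct_inf. signed_reflection qp qm g = of_real (1 - t) * \<chi> g + of_real t * \<psi> g"
    and g: "g \<in> carrier hyperoct_inf"
  shows "\<chi> g = \<psi> g"
proof -
  let ?\<phi> = "signed_reflection qp qm"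
  have eq': "?\<phi> \<sigma> = of_real (1 - t) * \<chi> \<sigma> + of_real t * \<psi> \<sigma>" if "\<sigma> \<in> hyperoct n" for \<sigma> n
    using eq hyperoct_in_carrier[OF that] by blast
  obtain m where s: "g \<in> hyperoct m" using g by auto
  define c where "c = ?\<phi> g"
  define d where "d = \<chi> g"
  have bound: "(1 - t) * real N * (cmod (d - c))\<^sup>2 \<le> 1" if N: "N \<ge> 1" for N
  proof -
    let ?A = "\<lambda>f. block_sum f m g N"
    have "?A ?\<phi> = of_real (1 - t) * ?A \<chi> + of_real t * ?A \<psi>"
    proof -
      have b: "block_conj m g i \<in> hyperoct (N * m + m)" if "i \<in> {1..N}" for i
        using block_conj_hyperoct(1)[OF s, of i] that hyperoct_mono[of "i * m + m" "N * m + m"] by auto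
      have "?A ?\<phi> = (\<Sum>i=1..N. \<Sum>j=1..N.
          of_real (1 - t) * \<chi> (inv_into UNIV (block_conj m g j) \<circ> block_conj m g i)
          + of_real t * \<psi> (inv_into UNIV (block_conj m g j) \<circ> block_conj m g i))"
        unfolding block_sum_def by (intro sum.cong refl eq'[OF hyperoct_comp[OF hyperoct_inv[OF b] b]])
      then show ?thesis by (simp only: block_sum_def sum.distrib sum_distrib_left)
    qed
    then have Re1: "Re (?A ?\<phi>) = (1 - t) * Re (?A \<chi>) + t * Re (?A \<psi>)" by simp
    have Re2: "Re (?A ?\<phi>) = real N + (real N ^ 2 - real N) * ((Re c)\<^sup>2 + (Im c)\<^sup>2)"
      unfolding block_sum_signed_reflection[OF \<phi> s] c_def cmod_power2
      by (simp add: power2_eq_square)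
    \<comment> \<open>\<open>w = d\<close> gives the best lower bound for \<open>\<chi>\<close>. For
      \<open>\<psi>\<close> below, \<open>w = c\<close> gives one linear in \<open>\<psi> g\<close>,
      which the convex relation can eliminate.\<close>
    have X: "Re (?A \<chi>) \<ge> real N ^ 2 * ((Re d)\<^sup>2 + (Im d)\<^sup>2)"
      using character_block_form[OF \<chi> s, of N d]
      by (simp add: complex_nonneg_Reals_iff d_def power2_eq_square algebra_simps)
    have Y: "Re (?A \<psi>) \<ge> real N ^ 2 *
        (2 * (Re c * Re (\<psi> g) + Im c * Im (\<psi> g)) - ((Re c)\<^sup>2 + (Im c)\<^sup>2))"
      using character_block_form[OF \<psi> s, of N c]
      by (simp add: complex_nonneg_Reals_iff power2_eq_square algebra_simps)
    have c: "Re c = (1 - t) * Re d + t * Re (\<psi> g)" "Im c = (1 - t) * Im d + t * Im (\<psi> g)"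
      using eq'[OF s] by (simp_all add: c_def d_def)
    have "real N > 0" using N by simp
    from block_bound[OF t this X Y trans[OF Re1[symmetric] Re2] c] show ?thesis
      by (simp only: cmod_power2 minus_complex.sel)
  qed
  have "(1 - t) * (cmod (d - c))\<^sup>2 = 0"
  proof (rule ccontr)
    assume "\<not> ?thesis"
    then have "(1 - t) * (cmod (d - c))\<^sup>2 > 0" using t by simp
    then obtain N where "1 < real N * ((1 - t) * (cmod (d - c))\<^sup>2)"
      using reals_Archimedean3 by blast
    moreover from this have "N \<ge> 1" by (cases N) auto
    ultimately show False using bound[of N] by (simp add: mult_ac)
  qed
  then have "d = c" using t by simp
  then have "\<chi> g = ?\<phi> g" by (simp add: c_def d_def)
  moreover have "of_real t * \<psi> g = ?\<phi> g - of_real (1 - t) * \<chi> g" using eq'[OF s] by simp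
  ultimately have "of_real t * (\<psi> g - ?\<phi> g) = 0" by (simp add: algebra_simps)
  then have "\<psi> g = ?\<phi> g" using t by (simp only: mult_eq_0_iff of_real_eq_0_iff right_minus_eq) auto
  with \<open>\<chi> g = ?\<phi> g\<close> show "\<chi> g = \<psi> g" by (simp only:)
qed

lemma signed_reflection_extreme:
  assumes "is_character hyperoct_inf (signed_reflection qp qm)"
  shows "is_extreme_character hyperoct_inf (signed_reflection qp qm)"
  unfolding is_extreme_character_def
  using assms signed_reflection_convex_combination[OF assms] by blast

section \<open>Necessity\<close>

text \<open>For \<open>a\<close> and \<open>b\<close> in \<open>{1, -1}\<close> this is the twist by
  a linear character, which changes only the signs of the parameters.\<close>

lemma signed_reflection_mult:
  "signed_reflection a b \<sigma> * signed_reflection qp qm \<sigma> = signed_reflection (a * qp) (b * qm) \<sigma>"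
  by (simp add: signed_reflection_def power_mult_distrib)

text \<open>The test vector is the linear character \<open>signed_reflection a b\<close> on all of
  \<open>hyperoct n\<close>. The form equals the group order times the sum of the twisted function,
  which the product formula evaluates.\<close>

lemma positive_definite_prod:
  assumes pd: "positive_definite_on hyperoct_inf (signed_reflection qp qm)"
    and ab: "a \<in> {1, -1}" "b \<in> {1, -1}"
  shows "(\<Prod>k<n. 1 + b * qm + 2 * of_nat k * (a * qp)) \<in> \<real>\<^sub>\<ge>\<^sub>0"
proof -
  let ?\<phi> = "signed_reflection qp qm" and ?c = "signed_reflection a b" and ?B = "hyperoct n"
  have inner: "(\<Sum>g\<in>?B. ?c g * cnj (?c h) * ?\<phi> (inv_into UNIV h \<circ> g)) = (\<Sum>\<rho>\<in>?B. signed_reflection (a * qp) (b * qm) \<rho>)"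
    if h: "h \<in> ?B" for h
  proof -
    have inv: "h \<circ> inv_into UNIV h = id" "inv_into UNIV h \<circ> h = id"
      using permutes_inv_o[OF hyperoct_permutes[OF h]] by auto
    \<comment> \<open>Substituting \<open>h \<circ> \<rho>\<close> for \<open>g\<close> makes the
      inner sum independent of \<open>h\<close>.\<close>
    have "bij_betw (\<lambda>\<rho>. h \<circ> \<rho>) ?B ?B"
      by (rule bij_betw_byWitness[where f' = "\<lambda>\<rho>. inv_into UNIV h \<circ> \<rho>"])
        (use h hyperoct_inv[OF h] hyperoct_comp inv in \<open>auto simp: comp_assoc[symmetric]\<close>)
    then have "(\<Sum>g\<in>?B. ?c g * cnj (?c h) * ?\<phi> (inv_into UNIV h \<circ> g))
        = (\<Sum>\<rho>\<in>?B. ?c (h \<circ> \<rho>) * cnj (?c h) * ?\<phi> (inv_into UNIV h \<circ> (h \<circ> \<rho>)))"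
      by (rule sum.reindex_bij_betw[symmetric])
    also have "\<dots> = (\<Sum>\<rho>\<in>?B. signed_reflection (a * qp) (b * qm) \<rho>)"
    proof (rule sum.cong[OF refl])
      fix \<rho> assume r: "\<rho> \<in> ?B"
      have "inv_into UNIV h \<circ> (h \<circ> \<rho>) = \<rho>" using inv(2) by (simp only: comp_assoc[symmetric] id_comp)
      moreover have "?c (h \<circ> \<rho>) * cnj (?c h) = ?c \<rho>"
        unfolding signed_reflection_linear_comp[OF ab h r]
        using signed_reflection_linear_inv(2)[OF ab h] by auto
      ultimately show "?c (h \<circ> \<rho>) * cnj (?c h) * ?\<phi> (inv_into UNIV h \<circ> (h \<circ> \<rho>))
          = signed_reflection (a * qp) (b * qm) \<rho>"
        by (simp only: signed_reflection_mult)
    qed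
    finally show ?thesis .
  qed
  have "(\<Sum>g\<in>?B. \<Sum>h\<in>?B. ?c g * cnj (?c h) * ?\<phi> (inv_into UNIV h \<circ> g)) \<in> \<real>\<^sub>\<ge>\<^sub>0"
    using positive_definite_on_hyperoctD[OF pd, of ?B "\<lambda>g. g" n ?c] by simp
  also have "(\<Sum>g\<in>?B. \<Sum>h\<in>?B. ?c g * cnj (?c h) * ?\<phi> (inv_into UNIV h \<circ> g))
      = (\<Sum>h\<in>?B. \<Sum>g\<in>?B. ?c g * cnj (?c h) * ?\<phi> (inv_into UNIV h \<circ> g))"
    by (rule sum.swap)
  also have "\<dots> = of_nat (card ?B) * (\<Sum>\<rho>\<in>?B. signed_reflection (a * qp) (b * qm) \<rho>)"
    by (simp add: inner)
  finally have "of_nat (card ?B) * (\<Sum>\<rho>\<in>?B. signed_reflection (a * qp) (b * qm) \<rho>) / of_nat (card ?B) \<in> \<real>\<^sub>\<ge>\<^sub>0"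
    by (intro nonneg_Reals_divide_I) auto
  moreover have "card ?B \<noteq> 0" using id_hyperoct[of n] by (metis card_0_eq empty_iff finite_hyperoct)
  ultimately show ?thesis by (simp add: sum_signed_reflection)
qed

text \<open>The factors decrease and become negative eventually. If none vanishes, the product up to
  and including the first negative one is negative.\<close>

lemma prod_arith_nonneg_zero:
  fixes u v :: real
  assumes v: "v > 0" and pos: "\<And>n. (\<Prod>k<n. u - real k * v) \<ge> 0"
  shows "\<exists>k::nat. u = real k * v"
proof (rule ccontr)
  assume none: "\<nexists>k::nat. u = real k * v"
  obtain k0 :: nat where "u < real k0 * v" using reals_Archimedean3[OF v] by blast
  then have ex: "\<exists>k::nat. u < real k * v" by blast
  define K where "K = (LEAST k::nat. u < real k * v)"
  have K: "u < real K * v" unfolding K_def by (rule LeastI_ex[OF ex])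
  have "u - real k * v > 0" if "k < K" for k
    using not_less_Least[of k "\<lambda>k. u < real k * v"] that none unfolding K_def[symmetric]
    by (metis diff_gt_0_iff_gt linorder_cases)
  then have "(\<Prod>k<K. u - real k * v) > 0" by (intro prod_pos) auto
  then have "(\<Prod>k<Suc K. u - real k * v) < 0" using K by (simp add: mult_less_0_iff)
  then show False using pos[of "Suc K"] by simp
qed

text \<open>One factor confines \<open>qm\<close> to \<open>[-1, 1]\<close>, two factors make
  \<open>qp\<close> real, and products of all lengths make \<open>1 + qm\<close> and
  \<open>1 - qm\<close> natural multiples of \<open>2 * \<bar>qp\<bar>\<close> unless
  \<open>qp = 0\<close>.\<close>

lemma positive_definite_parameters:
  assumes pd: "positive_definite_on hyperoct_inf (signed_reflection qp qm)"
  shows "(\<exists>(M::nat) (N::nat). \<exists>\<epsilon>\<in>{1, -1 :: complex}. M + N \<noteq> 0 \<and>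
            qp = \<epsilon> / of_nat (M + N) \<and> qm = (of_nat M - of_nat N) / of_nat (M + N)) \<or>
        (qp = 0 \<and> (\<exists>r::real. qm = of_real r \<and> -1 \<le> r \<and> r \<le> 1))"
proof -
  note P = positive_definite_prod[OF pd]
  have "1 + qm \<in> \<real>\<^sub>\<ge>\<^sub>0" "1 - qm \<in> \<real>\<^sub>\<ge>\<^sub>0" using P[of 1 1 1] P[of 1 "-1" 1] by simp_all
  then obtain y where y: "qm = of_real y" "-1 \<le> y" "y \<le> 1"
    by (intro that[of "Re qm"]) (auto simp: complex_nonneg_Reals_iff complex_eq_iff)
  \<comment> \<open>Of the two factors the first is \<open>1 + b * y\<close>. The sign
    \<open>b\<close> is chosen to make it nonzero, which forces the second to be real.\<close>
  have "Im qp = 0"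
  proof (cases "y = -1")
    case True
    then show ?thesis using P[of 1 "-1" 2] by (simp add: numeral_2_eq_2 y complex_nonneg_Reals_iff)
  next
    case False
    then show ?thesis using P[of 1 1 2] by (simp add: numeral_2_eq_2 y complex_nonneg_Reals_iff)
  qed
  then obtain x where x: "qp = of_real x" by (metis complex_is_Real_iff Reals_cases)
  have R: "(\<Prod>k<n. 1 + b * y + 2 * real k * (a * x)) \<ge> 0" if "a \<in> {1, -1}" "b \<in> {1, -1}" for n a b
  proof -
    have "(\<Prod>k<n. 1 + of_real b * qm + 2 * of_nat k * (of_real a * qp)) \<in> \<real>\<^sub>\<ge>\<^sub>0"
      using that by (intro P) auto
    also have "(\<Prod>k<n. 1 + of_real b * qm + 2 * of_nat k * (of_real a * qp))
        = complex_of_real (\<Prod>k<n. 1 + b * y + 2 * real k * (a * x))"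
      by (simp add: x y)
    finally show ?thesis by (simp only: nonneg_Reals_of_real_iff)
  qed
  show ?thesis
  proof (cases "x = 0")
    case True
    then show ?thesis using x y by auto
  next
    case False
    \<comment> \<open>With this sign \<open>a * x\<close> is negative, so the factors form a
      decreasing progression.\<close>
    define a where "a = - sgn x"
    have a: "a \<in> {1, -1}" "a * x = - \<bar>x\<bar>" using False by (auto simp: a_def sgn_if)
    have v: "2 * \<bar>x\<bar> > 0" using False by simp
    have E: "\<exists>k::nat. 1 + b * y = real k * (2 * \<bar>x\<bar>)" if "b \<in> {1, -1}" for b
      by (rule prod_arith_nonneg_zero[OF v]) (use R[OF a(1) that] a(2) in \<open>simp add: algebra_simps\<close>)
    obtain M N :: nat where MN: "1 + y = real M * (2 * \<bar>x\<bar>)" "1 - y = real N * (2 * \<bar>x\<bar>)"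
      using E[of 1] E[of "-1"] by auto
    \<comment> \<open>The sum of the two equations fixes the scale \<open>\<bar>x\<bar>\<close>, and
      their difference gives \<open>y\<close> below.\<close>
    have one: "real (M + N) * \<bar>x\<bar> = 1" using MN by (simp add: algebra_simps)
    then have nz: "M + N \<noteq> 0" by (intro notI) simp
    have "\<bar>x\<bar> = 1 / real (M + N)" using one nz by (simp add: field_simps del: of_nat_add)
    moreover have "x = sgn x * \<bar>x\<bar>" by (simp add: sgn_mult_abs)
    ultimately have x': "x = sgn x / real (M + N)" by simp
    have "y = (real M - real N) * \<bar>x\<bar>" using MN by (simp add: algebra_simps)
    then have y': "y = (real M - real N) / real (M + N)" using \<open>\<bar>x\<bar> = 1 / real (M + N)\<close> by simp
    have "qp = of_real (sgn x) / of_nat (M + N)"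
      unfolding x by (subst x') simp
    moreover have "qm = (of_nat M - of_nat N) / of_nat (M + N)"
      unfolding y(1) by (subst y') simp
    moreover have "complex_of_real (sgn x) \<in> {1, -1}" using False by (auto simp: sgn_if)
    ultimately show ?thesis using nz by blast
  qed
qed

theorem theorem1p1:
  fixes qp qm :: complex
  shows
    "(positive_definite_on hyperoct_inf (signed_reflection qp qm) \<longleftrightarrow>
        is_character hyperoct_inf (signed_reflection qp qm)) \<and>
     (is_character hyperoct_inf (signed_reflection qp qm) \<longleftrightarrow>
        is_extreme_character hyperoct_inf (signed_reflection qp qm)) \<and>
     (is_extreme_character hyperoct_inf (signed_reflection qp qm) \<longleftrightarrow>
        ((\<exists>(M::nat) (N::nat). \<exists>\<epsilon>\<in>{1, -1 :: complex}. M + N \<noteq> 0 \<and>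
            qp = \<epsilon> / of_nat (M + N) \<and>
            qm = (of_nat M - of_nat N) / of_nat (M + N)) \<or>
        (qp = 0 \<and> (\<exists>r::real. qm = of_real r \<and> -1 \<le> r \<and> r \<le> 1))))"
    (is "(?PD \<longleftrightarrow> ?C) \<and> (?C \<longleftrightarrow> ?E) \<and> (?E \<longleftrightarrow> ?P)")
proof -
  have "?PD \<longleftrightarrow> ?C" using is_character_signed_reflection_iff by blast
  moreover have "?C \<longleftrightarrow> ?E" using signed_reflection_extreme by (auto simp: is_extreme_character_def)
  moreover have "?PD \<Longrightarrow> ?P" by (rule positive_definite_parameters)
  moreover have "?P \<Longrightarrow> ?PD"
    using positive_definite_signed_reflection positive_definite_signed_reflection_zero by blast
  ultimately show ?thesis by blast
qed

end
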